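(* Let $\Phi=(f_i)_{i\in\mathcal{I}}\in\mathfrak{S}_N$ be an IFS, $\mathcal{I}=\{1,\dots,N\}$. Suppose that there exists $\alpha>0$ such that for each $i\neq j\in\mathcal{I}$ there exists $x_{i,j}\in[0,1]$ with $$\left|\frac{f_i''(x_{i,j})}{f_i'(x_{i,j})}-\frac{f_j''(x_{i,j})}{f_j'(x_{i,j})}\right|\ge\alpha.$$ Let $\beta=\sup_{x\in[0,1],\,i\in\mathcal{I}}\left|\frac{f_i''(x)}{f_i'(x)}\right|$. Then $\beta>0$, and if $\alpha>2\beta\cdot c_{\max}/(1-c_{\max})$, then $$\sup_{x\in[0,1]}|H_{\mathbf{i}}(x)-H_{\mathbf{j}}(x)|>0$$ for all distinct $\mathbf{i},\mathbf{j}\in\Sigma\cup\Sigma_*$ with $|\mathbf{i}|=|\mathbf{j}|$. In particular, in that case $\Phi$ satisfies the SESC.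
   Context: Fix $\epsilon>0$, write $I=[0,1]$ and, for $\delta>0$, $\mathcal{B}_\delta=\{z\in\mathbb{C}: \exists x\in I,\ |z-x|<\delta\}$. $\mathcal{S}^\omega_\epsilon(I)$ is the class of maps $f:\mathbb{R}\to\mathbb{R}$ such that: (A) $f$ is (extends to be) complex analytic on $\mathcal{B}_{2\epsilon}$; (B) $f(I)\subseteq I$ and $f(\overline{\mathcal{B}_\epsilon})\subseteq\mathcal{B}_\epsilon$; (C) $0<|f'(x)|<1$ for all $x\in\overline{\mathcal{B}_\epsilon}$. $\mathfrak{S}_N$ is the set of ordered $N$-tuples (iterated function systems, IFSs) $\Phi=(f_i)_{i=1}^N$ with $f_i\in\mathcal{S}^\omega_\epsilon(I)$. For such $\Phi$, $c_{\max}=\sup_{x\in\overline{\mathcal{B}_\epsilon},\,i\in\mathcal{I}}|f_i'(x)|\in(0,1)$. Let $\Sigma_n=\mathcal{I}^n$, $\Sigma_*=\bigcup_{n\ge0}\Sigma_n$ (with $\Sigma_0=\{\emptyset\}$), $\Sigma=\mathcal{I}^{\mathbb{N}}$; $|\mathbf{i}|$ is the length of a word ($\infty$ for $\mathbf{i}\in\Sigma$). For a finite word, $f_{i_1,\dots,i_n}=f_{i_1}\circ\cdots\circ f_{i_n}$, $f_\emptyset=\mathrm{Id}$; and $\mathbf{i}_{n}^1=(i_n,\dots,i_1)$, so $f_{\mathbf{i}_n^1}=f_{i_n}\circ\cdots\circ f_{i_1}$, with $\mathbf{i}_0^1=\emptyset$. For $\mathbf{i}\in\Sigma\cup\Sigma_*$,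 $$H_{\mathbf{i}}(x)=\sum_{n=1}^{|\mathbf{i}|}\frac{f''_{i_n}}{f'_{i_n}}\big(f_{\mathbf{i}_{n-1}^1}(x)\big)\cdot f'_{\mathbf{i}_{n-1}^1}(x).$$ $\Phi$ satisfies the strong exponential separation condition (SESC) if there exists $c>0$ such that $\sup_{x\in[0,1]}|f_{\mathbf{i}}(x)-f_{\mathbf{j}}(x)|\ge c^n$ for all $n\in\mathbb{N}$ and all $\mathbf{i}\ne\mathbf{j}$ in $\Sigma_n$.
   Formalization: The formal statement assumes N ≥ 2: for N = 1 the condition on α is vacuous and β > 0 fails for a single affine map such as x/2 + 1/4, while the remaining conclusions are vacuous. *)

theory Defs
  imports "HOL-Complex_Analysis.Complex_Analysis" "HOL-Library.Extended_Nat"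
begin

definition nbhd :: "real \<Rightarrow> complex set" where
  "nbhd \<delta> = {z. \<exists>x\<in>{0..1::real}. cmod (z - of_real x) < \<delta>}"

definition is_cext :: "real \<Rightarrow> (real \<Rightarrow> real) \<Rightarrow> (complex \<Rightarrow> complex) \<Rightarrow> bool" where
  "is_cext \<epsilon> f F \<longleftrightarrow> F analytic_on nbhd (2 * \<epsilon>) \<and>
     (\<forall>x::real. of_real x \<in> nbhd (2 * \<epsilon>) \<longrightarrow> F (of_real x) = of_real (f x))"

text \<open>The complex extension of a real map; by \<open>is_cext_unique\<close> below it does not
  depend on the choice, as far as points of \<^term>\<open>nbhd (2 * \<epsilon>)\<close> are concerned.\<close>

definition cext :: "real \<Rightarrow> (real \<Rightarrow> real) \<Rightarrow> complex \<Rightarrow> complex" where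
  "cext \<epsilon> f = (SOME F. is_cext \<epsilon> f F)"

definition S_omega :: "real \<Rightarrow> (real \<Rightarrow> real) set" where
  "S_omega \<epsilon> = {f. (\<exists>F. is_cext \<epsilon> f F) \<and>
     f ` {0..1} \<subseteq> {0..1} \<and>
     cext \<epsilon> f ` closure (nbhd \<epsilon>) \<subseteq> nbhd \<epsilon> \<and>
     (\<forall>z\<in>closure (nbhd \<epsilon>). 0 < cmod (deriv (cext \<epsilon> f) z) \<and> cmod (deriv (cext \<epsilon> f) z) < 1)}"

text \<open>An \<open>N\<close>-tuple is a function on the index set \<open>{1..N}\<close>; its values elsewhere are
  never used.\<close>

definition IFS :: "real \<Rightarrow> nat \<Rightarrow> (nat \<Rightarrow> real \<Rightarrow> real) set" where
  "IFS \<epsilon> N = {1..N} \<rightarrow> S_omega \<epsilon>"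

definition c_max :: "real \<Rightarrow> nat \<Rightarrow> (nat \<Rightarrow> real \<Rightarrow> real) \<Rightarrow> real" where
  "c_max \<epsilon> N \<Phi> = (SUP (z, i)\<in>closure (nbhd \<epsilon>) \<times> {1..N}. cmod (deriv (cext \<epsilon> (\<Phi> i)) z))"

fun comp_word :: "(nat \<Rightarrow> real \<Rightarrow> real) \<Rightarrow> nat list \<Rightarrow> real \<Rightarrow> real" where
  "comp_word \<Phi> [] = id"
| "comp_word \<Phi> (i # u) = \<Phi> i \<circ> comp_word \<Phi> u"

text \<open>Finite or infinite words. The letters are numbered from 1, so the first letter is
  \<open>u ! 0\<close> for \<open>Fin_word u\<close> and \<open>s 0\<close> for \<open>Inf_word s\<close>.\<close>

datatype word = Fin_word "nat list" | Inf_word "nat \<Rightarrow> nat"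

fun word_length :: "word \<Rightarrow> enat" where
  "word_length (Fin_word u) = enat (length u)"
| "word_length (Inf_word s) = \<infinity>"

fun letter :: "word \<Rightarrow> nat \<Rightarrow> nat" where
  "letter (Fin_word u) n = u ! (n - 1)"
| "letter (Inf_word s) n = s (n - 1)"

definition words :: "nat \<Rightarrow> word set" where
  "words N = {w. \<forall>n\<ge>1. enat n \<le> word_length w \<longrightarrow> letter w n \<in> {1..N}}"

text \<open>The word \<open>(i\<^sub>n, \<dots>, i\<^sub>1)\<close>.\<close>

definition rev_prefix :: "word \<Rightarrow> nat \<Rightarrow> nat list" where
  "rev_prefix w n = rev (map (letter w) [1..<Suc n])"

definition H_term :: "(nat \<Rightarrow> real \<Rightarrow> real) \<Rightarrow> word \<Rightarrow> nat \<Rightarrow> real \<Rightarrow> real" where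
  "H_term \<Phi> w n x =
     (let f = \<Phi> (letter w n); g = comp_word \<Phi> (rev_prefix w (n - 1))
      in deriv (deriv f) (g x) / deriv f (g x) * deriv g x)"

definition H :: "(nat \<Rightarrow> real \<Rightarrow> real) \<Rightarrow> word \<Rightarrow> real \<Rightarrow> real" where
  "H \<Phi> w x = (case w of
       Fin_word u \<Rightarrow> (\<Sum>n=1..length u. H_term \<Phi> w n x)
     | Inf_word s \<Rightarrow> (\<Sum>n. H_term \<Phi> w (Suc n) x))"

definition SESC :: "nat \<Rightarrow> (nat \<Rightarrow> real \<Rightarrow> real) \<Rightarrow> bool" where
  "SESC N \<Phi> \<longleftrightarrow> (\<exists>c>0. \<forall>n u v.
     length u = n \<and> set u \<subseteq> {1..N} \<and> length v = n \<and> set v \<subseteq> {1..N} \<and> u \<noteq> v \<longrightarrow>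
     (SUP x\<in>{0..1}. \<bar>comp_word \<Phi> u x - comp_word \<Phi> v x\<bar>) \<ge> c ^ n)"

lemma nbhd_eq: "nbhd \<delta> = (\<Union>x\<in>{0..1::real}. ball (of_real x) \<delta>)"
  by (auto simp: nbhd_def dist_norm norm_minus_commute)

lemma open_nbhd: "open (nbhd \<delta>)"
  unfolding nbhd_eq by blast

lemma convex_nbhd: "convex (nbhd \<delta>)"
proof -
  have "nbhd \<delta> = (\<Union>x\<in>of_real ` {0..1::real}. \<Union>y\<in>ball 0 \<delta>. {x + y})"
  proof (intro equalityI subsetI)
    fix z assume "z \<in> nbhd \<delta>"
    then obtain x :: real where "x \<in> {0..1}" "cmod (z - of_real x) < \<delta>"
      by (auto simp: nbhd_def)
    then show "z \<in> (\<Union>x\<in>of_real ` {0..1::real}. \<Union>y\<in>ball 0 \<delta>. {x + y})"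
      by (auto intro!: bexI[of _ x] bexI[of _ "z - of_real x"])
  qed (force simp: nbhd_def)
  moreover have "convex (complex_of_real ` {0..1})"
    by (intro convex_linear_image bounded_linear.linear[OF bounded_linear_of_real]) auto
  ultimately show ?thesis
    using convex_sums[of "complex_of_real ` {0..1}" "ball 0 \<delta>"] by auto
qed

lemma is_cext_unique:
  assumes "\<epsilon> > 0" "is_cext \<epsilon> f F" "is_cext \<epsilon> f G" "z \<in> nbhd (2 * \<epsilon>)"
  shows "F z = G z"
proof -
  have 0: "of_real x \<in> nbhd (2 * \<epsilon>)" if "x \<in> {0..1}" for x :: real
    unfolding nbhd_def using that assms(1) by (auto intro!: bexI[of _ x])
  have "0 islimpt {0..1::real}"
    by simp
  then have lim: "complex_of_real 0 islimpt of_real ` {0..1}"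
    unfolding islimpt_sequential
    by (elim exE conjE) (rule_tac x="\<lambda>n. of_real (f n)" in exI, auto simp: tendsto_of_real_iff[of _ 0, simplified])
  have "F z - G z = 0"
  proof (rule analytic_continuation[where f="\<lambda>z. F z - G z" and S="nbhd (2 * \<epsilon>)"
        and U="of_real ` {0..1}" and \<xi>="of_real 0"])
    show "(\<lambda>z. F z - G z) holomorphic_on nbhd (2 * \<epsilon>)"
      using assms(2,3) unfolding is_cext_def
      by (intro holomorphic_intros analytic_imp_holomorphic) auto
    show "connected (nbhd (2 * \<epsilon>))"
      by (intro convex_connected convex_nbhd)
    show "F z - G z = 0" if "z \<in> of_real ` {0..1}" for z
      using that assms(2,3) 0 by (auto simp: is_cext_def)
  qed (use open_nbhd lim assms(4) 0 0[of 0] in auto)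
  then show ?thesis by simp
qed

end

theory Submission
  imports Defs
begin

text \<open>
  All maps are continued to complex neighbourhoods. Writing \<open>R\<^sub>i = f\<^sub>i'' / f\<^sub>i'\<close>, the function \<open>H\<close> satisfies the
  recursion \<open>H\<^sub>i = R\<^bsub>i\<^sub>1\<^esub> + f'\<^bsub>i\<^sub>1\<^esub> \<cdot> (H\<^bsub>\<sigma>i\<^esub> \<circ> f\<^bsub>i\<^sub>1\<^esub>)\<close> with \<open>\<sigma>\<close> the left shift. If two words differ in the
  first letter, the geometric bound on the tails leaves a gap of at least
  \<open>\<delta> = \<alpha> - 2 \<beta> c / (1 - c) > 0\<close> at \<open>x\<^bsub>i,j\<^esub>\<close>; a common prefix is removed one letter at a time, and the identity
  theorem ensures that the difference does not vanish on the image of \<open>[0,1]\<close>.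

  For the SESC, write \<open>f\<^sub>u = F \<circ> h\<close> and \<open>f\<^sub>v = G \<circ> h\<close>, where the innermost letters of \<open>F\<close> and \<open>G\<close> differ, and let
  \<open>E = F'' / F' - G'' / G'\<close>, which is a difference of two functions \<open>H\<close>. It is uniformly bounded
  and at least \<open>\<delta>\<close> somewhere on \<open>[0,1]\<close>, so by Montel's theorem some derivative of \<open>E\<close> of
  bounded order is bounded below at every point of \<open>[0,1]\<close>. If \<open>F - G\<close> were smaller than \<open>c\<^sup>n\<close> for a tiny
  \<open>c\<close> on the interval \<open>h [0,1]\<close>, whose length decays at most exponentially in \<open>n\<close>, then
  its first two derivatives, hence \<open>E\<close>, hence the derivatives of \<open>E\<close> up to any fixed order would
  be small there as well: a contradiction.
\<close>

subsection \<open>Holomorphic functions near the unit interval\<close>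

lemma of_real_in_nbhd: "0 < \<delta> \<Longrightarrow> x \<in> {0..1} \<Longrightarrow> complex_of_real x \<in> nbhd \<delta>"
  unfolding nbhd_def by force

lemma cball_subset_nbhd: "r < \<delta> \<Longrightarrow> x \<in> {0..1} \<Longrightarrow> cball (complex_of_real x) r \<subseteq> nbhd \<delta>"
  unfolding nbhd_def by (force simp: dist_norm norm_minus_commute)

lemma norm_nbhd_less: "z \<in> nbhd \<delta> \<Longrightarrow> cmod z < 1 + \<delta>"
proof -
  assume "z \<in> nbhd \<delta>"
  then obtain x :: real where x: "x \<in> {0..1}" "cmod (z - of_real x) < \<delta>"
    by (auto simp: nbhd_def)
  have "cmod z \<le> cmod (z - of_real x) + cmod (of_real x)"
    by (metis diff_add_cancel norm_triangle_ineq)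
  with x show ?thesis by auto
qed

lemma compact_closure_nbhd: "compact (closure (nbhd \<delta>))"
  using norm_nbhd_less[of _ \<delta>] by (auto simp: compact_closure bounded_iff intro!: exI[of _ "1 + \<delta>"] less_imp_le)

lemma closure_nbhd_subset:
  assumes "\<epsilon> > 0" shows "closure (nbhd \<epsilon>) \<subseteq> nbhd (2 * \<epsilon>)"
proof
  fix z assume "z \<in> closure (nbhd \<epsilon>)"
  then obtain y where y: "y \<in> nbhd \<epsilon>" "dist y z < \<epsilon>"
    using assms by (auto simp: closure_approachable)
  then obtain x :: real where x: "x \<in> {0..1}" "cmod (y - of_real x) < \<epsilon>"
    by (auto simp: nbhd_def)
  have "cmod (z - of_real x) \<le> cmod (z - y) + cmod (y - of_real x)"
    by (metis norm_triangle_ineq diff_add_eq diff_add_cancel add_diff_eq)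
  also have "\<dots> < 2 * \<epsilon>"
    using x y by (simp add: dist_norm norm_minus_commute)
  finally show "z \<in> nbhd (2 * \<epsilon>)" using x by (auto simp: nbhd_def)
qed

section \<open>Cauchy estimates and interpolation between derivatives\<close>

lemma higher_deriv_bound_nbhd:
  assumes "\<epsilon> > 0" "g holomorphic_on nbhd \<epsilon>" "\<And>z. z \<in> nbhd \<epsilon> \<Longrightarrow> cmod (g z) \<le> B" "x \<in> {0..1::real}"
  shows "cmod ((deriv ^^ n) g (of_real x)) \<le> fact n * B / (\<epsilon> / 2) ^ n"
proof -
  have sub: "cball (complex_of_real x) (\<epsilon> / 2) \<subseteq> nbhd \<epsilon>"
    using assms by (intro cball_subset_nbhd) auto
  show ?thesis
  proof (rule Cauchy_inequality)
    show "g holomorphic_on ball (of_real x) (\<epsilon> / 2)"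
      using assms(2) sub by (meson ball_subset_cball holomorphic_on_subset order_trans)
    show "continuous_on (cball (of_real x) (\<epsilon> / 2)) g"
      using assms(2) sub by (meson holomorphic_on_imp_continuous_on holomorphic_on_subset)
    show "cmod (g y) \<le> B" if "cmod (of_real x - y) = \<epsilon> / 2" for y
      using that sub by (intro assms(3)) (auto simp: dist_norm)
  qed (use assms in auto)
qed

lemma higher_deriv_has_field_derivative:
  assumes "g holomorphic_on S" "open S" "z \<in> S"
  shows "((deriv ^^ n) g has_field_derivative (deriv ^^ Suc n) g z) (at z within T)"
  using holomorphic_derivI[OF holomorphic_higher_deriv[OF assms(1,2)] assms(2,3)]
  by (simp add: has_field_derivative_at_within)

lemma convex_of_real_image_unit: "convex (complex_of_real ` {0..1})"
  by (intro convex_linear_image bounded_linear.linear[OF bounded_linear_of_real]) auto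

lemma higher_deriv_lipschitz:
  assumes "\<epsilon> > 0" "g holomorphic_on nbhd \<epsilon>" "\<And>z. z \<in> nbhd \<epsilon> \<Longrightarrow> cmod (g z) \<le> B"
    and xy: "x \<in> {0..1::real}" "y \<in> {0..1}"
  shows "cmod ((deriv ^^ n) g (of_real y) - (deriv ^^ n) g (of_real x))
           \<le> fact (Suc n) * B / (\<epsilon> / 2) ^ Suc n * \<bar>y - x\<bar>"
proof -
  have "cmod ((deriv ^^ n) g (of_real y) - (deriv ^^ n) g (of_real x))
           \<le> fact (Suc n) * B / (\<epsilon> / 2) ^ Suc n * cmod (of_real y - of_real x)"
  proof (rule field_differentiable_bound[OF convex_of_real_image_unit])
    show "((deriv ^^ n) g has_field_derivative (deriv ^^ Suc n) g z) (at z within of_real ` {0..1})"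
      if "z \<in> of_real ` {0..1}" for z
      using that assms(1) of_real_in_nbhd
      by (intro higher_deriv_has_field_derivative[OF assms(2) open_nbhd]) auto
    show "cmod ((deriv ^^ Suc n) g z) \<le> fact (Suc n) * B / (\<epsilon> / 2) ^ Suc n"
      if "z \<in> of_real ` {0..1}" for z
      using that higher_deriv_bound_nbhd[OF assms(1-3), where n="Suc n"] by auto
  qed (use xy in auto)
  then show ?thesis by (simp add: norm_of_real flip: of_real_diff)
qed

text \<open>First-order Taylor expansion of the n-th derivative along the real segment, with the
  Cauchy estimate for the remainder. It recovers derivative n + 1 from a difference of two values of
  derivative n.\<close>

lemma higher_deriv_taylor_bound:
  assumes "\<epsilon> > 0" "g holomorphic_on nbhd \<epsilon>" "\<And>z. z \<in> nbhd \<epsilon> \<Longrightarrow> cmod (g z) \<le> B"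
    and xy: "x \<in> {0..1::real}" "y \<in> {0..1}"
  shows "cmod ((deriv ^^ n) g (of_real y) - (deriv ^^ n) g (of_real x)
            - (deriv ^^ Suc n) g (of_real x) * of_real (y - x))
           \<le> fact (Suc (Suc n)) * B / (\<epsilon> / 2) ^ Suc (Suc n) * \<bar>y - x\<bar>\<^sup>2"
proof -
  have "cmod ((deriv ^^ (n + 0)) g (of_real y) - (\<Sum>i\<le>1. (deriv ^^ (n + i)) g (of_real x) * (of_real y - of_real x) ^ i / fact i))
           \<le> fact (n + Suc 1) * B / (\<epsilon> / 2) ^ (n + Suc 1) * cmod (of_real y - of_real x) ^ Suc 1 / fact 1"
  proof (rule complex_Taylor[OF convex_of_real_image_unit])
    show "((deriv ^^ (n + i)) g has_field_derivative (deriv ^^ (n + Suc i)) g z) (at z within of_real ` {0..1})"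
      if "z \<in> of_real ` {0..1}" for z i
      using that assms(1) of_real_in_nbhd higher_deriv_has_field_derivative[OF assms(2) open_nbhd, of z "n + i"]
      by auto
    show "cmod ((deriv ^^ (n + Suc 1)) g z) \<le> fact (n + Suc 1) * B / (\<epsilon> / 2) ^ (n + Suc 1)"
      if "z \<in> of_real ` {0..1}" for z
      using that higher_deriv_bound_nbhd[OF assms(1-3), where n="n + Suc 1"] by auto
  qed (use xy in auto)
  then show ?thesis
    by (simp add: numeral_2_eq_2 norm_of_real diff_diff_eq flip: of_real_diff del: power_Suc)
qed

text \<open>Landau's interpolation inequality, iterated: with step \<open>t\<close>, smallness \<open>t\<^sup>2\<close> of a function gives
  smallness \<open>O(t)\<close> of its derivative, whence the exponent \<open>2 ^ q\<close>.\<close>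

lemma small_higher_derivs:
  assumes "\<epsilon> > 0" "B \<ge> 0"
  shows "\<exists>A\<ge>1. \<forall>g a b t. g holomorphic_on nbhd \<epsilon> \<and> (\<forall>z\<in>nbhd \<epsilon>. cmod (g z) \<le> B) \<and>
     0 \<le> a \<and> b \<le> 1 \<and> 0 < t \<and> 2 * t \<le> b - a \<and>
     (\<forall>x\<in>{a..b}. cmod (g (of_real x)) \<le> t ^ (2 ^ q)) \<longrightarrow>
     (\<forall>j\<le>q. \<forall>x\<in>{a..b}. cmod ((deriv ^^ j) g (of_real x)) \<le> A * t)"
proof (induction q)
  case 0
  show ?case by (intro exI[of _ 1]) auto
next
  case (Suc q)
  then obtain A where A: "A \<ge> 1" and IH: "\<And>g a b t x j. \<lbrakk>g holomorphic_on nbhd \<epsilon>;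
     \<forall>z\<in>nbhd \<epsilon>. cmod (g z) \<le> B; 0 \<le> a; b \<le> 1; 0 < t; 2 * t \<le> b - a;
     \<forall>x\<in>{a..b}. cmod (g (of_real x)) \<le> t ^ (2 ^ q); j \<le> q; x \<in> {a..b}\<rbrakk>
       \<Longrightarrow> cmod ((deriv ^^ j) g (of_real x)) \<le> A * t"
    by blast
  define C where "C = fact (Suc (Suc q)) * B / (\<epsilon> / 2) ^ Suc (Suc q)"
  have C: "C \<ge> 0" using assms unfolding C_def by simp
  show ?case
  proof (intro exI[of _ "2 * A + C"] conjI allI impI ballI; (elim conjE)?)
    show "2 * A + C \<ge> 1" using A C by simp
  next
    fix g :: "complex \<Rightarrow> complex" and a b t j x
    assume g: "g holomorphic_on nbhd \<epsilon>" "\<forall>z\<in>nbhd \<epsilon>. cmod (g z) \<le> B" and ab: "0 \<le> a" "b \<le> 1"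
      and t: "0 < t" "2 * t \<le> b - a"
      and small: "\<forall>x\<in>{a..b}. cmod (g (of_real x)) \<le> t ^ 2 ^ Suc q"
      and j: "j \<le> Suc q" and x: "x \<in> {a..b}"
    have tt: "t\<^sup>2 \<le> t" using t ab by (simp add: power2_eq_square mult_left_le_one_le)
    \<comment> \<open>The induction hypothesis is used with step \<open>t\<^sup>2\<close>, whose
      power 2 ^ q is exactly the assumed bound \<open>t ^ 2 ^ Suc q\<close>.\<close>
    have *: "cmod ((deriv ^^ j) g (of_real x)) \<le> A * t\<^sup>2" if "j \<le> q" "x \<in> {a..b}" for j x
    proof (rule IH[OF g ab])
      show "\<forall>x\<in>{a..b}. cmod (g (complex_of_real x)) \<le> t\<^sup>2 ^ 2 ^ q"
        using small by (simp flip: power_mult)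
    qed (use t tt that in auto)
    show "cmod ((deriv ^^ j) g (of_real x)) \<le> (2 * A + C) * t"
    proof (cases "j \<le> q")
      case True
      have "A * t\<^sup>2 \<le> (2 * A + C) * t" using tt A C t by (intro mult_mono) auto
      with *[OF True x] show ?thesis by linarith
    next
      case False
      \<comment> \<open>A partner point at distance exactly t inside [a,b]; one of the two sides has
        room because 2 t \<le> b - a.\<close>
      define y where "y = (if x + t \<le> b then x + t else x - t)"
      have y: "y \<in> {a..b}" "\<bar>y - x\<bar> = t" using x t by (auto simp: y_def)
      have T: "cmod ((deriv ^^ q) g (of_real y) - (deriv ^^ q) g (of_real x)
            - (deriv ^^ Suc q) g (of_real x) * of_real (y - x)) \<le> C * t\<^sup>2"
        using higher_deriv_taylor_bound[OF assms(1) g(1), of B x y q] g(2) x y ab by (auto simp: C_def)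
      have tri: "cmod w \<le> cmod u + cmod v + cmod (u - v - w)" for u v w :: complex
        by (smt (verit, best) norm_triangle_ineq4 diff_diff_eq2 diff_diff_eq cancel_comm_monoid_add_class.diff_cancel
            add_diff_cancel_left' norm_minus_commute)
      have "t * cmod ((deriv ^^ Suc q) g (of_real x)) = cmod ((deriv ^^ Suc q) g (of_real x) * of_real (y - x))"
        using y by (simp add: norm_mult norm_of_real del: of_real_diff)
      also have "\<dots> \<le> A * t\<^sup>2 + A * t\<^sup>2 + C * t\<^sup>2"
        using tri[of "(deriv ^^ Suc q) g (of_real x) * of_real (y - x)"
            "(deriv ^^ q) g (of_real y)" "(deriv ^^ q) g (of_real x)"]
          *[of q x] *[of q y] x y T by simp
      also have "\<dots> = t * ((2 * A + C) * t)" by (simp add: power2_eq_square algebra_simps)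
      finally have "cmod ((deriv ^^ Suc q) g (of_real x)) \<le> (2 * A + C) * t" using t by simp
      moreover have "j = Suc q" using False j by simp
      ultimately show ?thesis by simp
    qed
  qed
qed

section \<open>Identity theorem and normal families\<close>

lemma holomorphic_zero_on_interval_imp_zero:
  assumes "\<epsilon> > 0" "g holomorphic_on nbhd \<epsilon>" "0 \<le> a" "a < b" "b \<le> 1"
    and "\<And>x. x \<in> {a..b} \<Longrightarrow> g (of_real x) = 0" "z \<in> nbhd \<epsilon>"
  shows "g z = 0"
proof (rule analytic_continuation[OF assms(2) open_nbhd convex_connected[OF convex_nbhd]])
  show "complex_of_real ` {a..b} \<subseteq> nbhd \<epsilon>" "complex_of_real a \<in> nbhd \<epsilon>"
    using assms by (auto intro!: of_real_in_nbhd)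
  have "a islimpt {a..b}" using assms by simp
  then obtain f where f: "\<And>n. f n \<in> {a..b} - {a}" "f \<longlonglongrightarrow> a"
    unfolding islimpt_sequential by blast
  then show "complex_of_real a islimpt of_real ` {a..b}"
    unfolding islimpt_sequential by (intro exI[of _ "\<lambda>n. of_real (f n)"]) (auto intro: tendsto_of_real)
qed (use assms in auto)

text \<open>For a single g the identity theorem forbids that all derivatives vanish at y.
  Compactness, by Montel for g and Bolzano-Weierstrass for x and y, makes the order p and the bound
  d independent of g, x and y. The point y may be far from the point x where g is known to be
  large.\<close>

lemma uniformly_nondegenerate_derivs:
  assumes \<epsilon>: "\<epsilon> > 0" and \<delta>: "\<delta> > 0"
  shows "\<exists>p. \<exists>d>0. \<forall>g. \<forall>x\<in>{0..1::real}. \<forall>y\<in>{0..1::real}.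
    g holomorphic_on nbhd \<epsilon> \<and> (\<forall>z\<in>nbhd \<epsilon>. cmod (g z) \<le> M) \<and> cmod (g (of_real x)) \<ge> \<delta> \<longrightarrow>
    (\<exists>q\<le>p. cmod ((deriv ^^ q) g (of_real y)) \<ge> d)"
proof (rule ccontr)
  assume contra: "\<not> ?thesis"
  \<comment> \<open>A counterexample to the claim for p = k and d = 1 / (k + 1).\<close>
  define P where "P g x y k \<longleftrightarrow> x \<in> {0..1} \<and> y \<in> {0..1} \<and> g holomorphic_on nbhd \<epsilon> \<and>
    (\<forall>z\<in>nbhd \<epsilon>. cmod (g z) \<le> M) \<and> cmod (g (of_real x)) \<ge> \<delta> \<and>
    (\<forall>q\<le>k. cmod ((deriv ^^ q) g (of_real y)) < 1 / real (Suc k))" for g and x y :: real and k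
  have "\<exists>g x y. P g x y k" for k
  proof (rule ccontr)
    assume "\<nexists>g x y. P g x y k"
    then have "\<forall>g. \<forall>x\<in>{0..1::real}. \<forall>y\<in>{0..1::real}.
      g holomorphic_on nbhd \<epsilon> \<and> (\<forall>z\<in>nbhd \<epsilon>. cmod (g z) \<le> M) \<and> cmod (g (of_real x)) \<ge> \<delta> \<longrightarrow>
      (\<exists>q\<le>k. cmod ((deriv ^^ q) g (of_real y)) \<ge> 1 / real (Suc k))"
      unfolding P_def by (meson not_le)
    moreover have "1 / real (Suc k) > 0" by simp
    ultimately show False using contra by blast
  qed
  then obtain G X Y where P: "\<And>k. P (G k) (X k) (Y k) k" by metis
  then have XY: "\<And>k. X k \<in> {0..1::real}" "\<And>k. Y k \<in> {0..1::real}"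
    and G: "\<And>k. G k holomorphic_on nbhd \<epsilon>" "\<And>k z. z \<in> nbhd \<epsilon> \<Longrightarrow> cmod (G k z) \<le> M"
    and GX: "\<And>k. cmod (G k (of_real (X k))) \<ge> \<delta>"
    and GY: "\<And>k q. q \<le> k \<Longrightarrow> cmod ((deriv ^^ q) (G k) (of_real (Y k))) < 1 / real (Suc k)"
    using P by (auto simp: P_def)
  obtain g r where g: "g holomorphic_on nbhd \<epsilon>" and r: "strict_mono (r :: nat \<Rightarrow> nat)"
    and lim: "\<And>K. \<lbrakk>compact K; K \<subseteq> nbhd \<epsilon>\<rbrakk> \<Longrightarrow> uniform_limit K (G \<circ> r) g sequentially"
    using Montel[OF open_nbhd[of \<epsilon>], of "range G" G] G by (smt (verit, best) image_iff subset_iff rangeI)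
  have "compact ({0..1::real} \<times> {0..1::real})" by (intro compact_Times) auto
  from this[unfolded compact_def, rule_format, of "\<lambda>n. (X (r n), Y (r n))"]
  obtain l r2 where l: "l \<in> {0..1} \<times> {0..1::real}" and r2: "strict_mono (r2 :: nat \<Rightarrow> nat)"
    and liml: "((\<lambda>n. (X (r n), Y (r n))) \<circ> r2) \<longlonglongrightarrow> l"
    using XY by blast
  obtain x y where xy: "l = (x, y)" "x \<in> {0..1}" "y \<in> {0..1}" using l by auto
  define s where "s = r \<circ> r2"
  have s: "strict_mono s" using r r2 by (simp add: s_def strict_mono_o)
  have limX: "(\<lambda>n. X (s n)) \<longlonglongrightarrow> x" and limY: "(\<lambda>n. Y (s n)) \<longlonglongrightarrow> y"
    using tendsto_fst[OF liml] tendsto_snd[OF liml] by (simp_all add: xy s_def o_def)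
  have lims: "(\<lambda>n. (deriv ^^ q) (G (s n)) (of_real u)) \<longlonglongrightarrow> (deriv ^^ q) g (of_real u)"
    if "u \<in> {0..1}" for u q
  proof (rule higher_deriv_complex_uniform_limit)
    have sub: "cball (complex_of_real u) (\<epsilon> / 2) \<subseteq> nbhd \<epsilon>"
      using that \<epsilon> by (intro cball_subset_nbhd) auto
    have "uniform_limit (cball (of_real u) (\<epsilon> / 2)) (\<lambda>n. (G \<circ> r) (r2 n)) g sequentially"
      using filterlim_compose[OF lim[OF compact_cball sub] filterlim_subseq[OF r2]] .
    then show "uniform_limit (ball (of_real u) (\<epsilon> / 2)) (\<lambda>n. G (s n)) g sequentially"
      unfolding s_def o_def using ball_subset_cball by (rule uniform_limit_on_subset)
    show "\<forall>\<^sub>F n in sequentially. G (s n) holomorphic_on ball (of_real u) (\<epsilon> / 2)"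
      using holomorphic_on_subset[OF G(1)] sub by (meson always_eventually ball_subset_cball order_trans)
  qed (use \<epsilon> in auto)
  \<comment> \<open>The evaluation points move with n. The common bound M gives all members of the
    sequence the same Lipschitz constant for the q-th derivative, which reduces the claim to a fixed
    point.\<close>
  have lims': "(\<lambda>n. (deriv ^^ q) (G (s n)) (of_real (U n))) \<longlonglongrightarrow> (deriv ^^ q) g (of_real u)"
    if U: "\<And>n. U n \<in> {0..1}" "u \<in> {0..1}" "U \<longlonglongrightarrow> u" for U u q
  proof -
    have "(\<lambda>n. (deriv ^^ q) (G (s n)) (of_real (U n)) - (deriv ^^ q) (G (s n)) (of_real u)) \<longlonglongrightarrow> 0"
    proof (rule Lim_null_comparison[OF always_eventually])
      show "\<forall>n. cmod ((deriv ^^ q) (G (s n)) (of_real (U n)) - (deriv ^^ q) (G (s n)) (of_real u))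
        \<le> fact (Suc q) * M / (\<epsilon> / 2) ^ Suc q * \<bar>U n - u\<bar>"
        using higher_deriv_lipschitz[OF \<epsilon> G] U by blast
      show "(\<lambda>n. fact (Suc q) * M / (\<epsilon> / 2) ^ Suc q * \<bar>U n - u\<bar>) \<longlonglongrightarrow> 0"
        using U(3) by (intro tendsto_mult_right_zero tendsto_rabs_zero) (simp add: LIM_zero)
    qed
    from tendsto_add[OF this lims[OF U(2), of q]] show ?thesis by simp
  qed
  have "cmod (g (of_real x)) \<ge> \<delta>"
    using tendsto_norm[OF lims'[of "\<lambda>n. X (s n)" x 0]] XY xy limX GX
    by (intro tendsto_lowerbound[of _ "cmod (g (of_real x))" sequentially]) auto
  moreover have "(deriv ^^ q) g (of_real y) = 0" for q
  proof -
    have "(\<lambda>n. (deriv ^^ q) (G (s n)) (of_real (Y (s n)))) \<longlonglongrightarrow> 0"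
    proof (rule Lim_null_comparison)
      show "\<forall>\<^sub>F n in sequentially. cmod ((deriv ^^ q) (G (s n)) (of_real (Y (s n)))) \<le> 1 / real (Suc (s n))"
        using eventually_ge_at_top[of q]
      proof eventually_elim
        case (elim n)
        then have "q \<le> s n" using seq_suble[OF s, of n] by linarith
        then show ?case using GY[of q "s n"] by linarith
      qed
      show "(\<lambda>n. 1 / real (Suc (s n))) \<longlonglongrightarrow> 0"
        using filterlim_compose[OF lim_1_over_n[THEN LIMSEQ_Suc] filterlim_subseq[OF s]] by simp
    qed
    then show ?thesis using lims'[of "\<lambda>n. Y (s n)" y q] XY xy limY LIMSEQ_unique by blast
  qed
  then have "g (of_real x) = 0"
    using holomorphic_fun_eq_0_on_connected[OF g open_nbhd convex_connected[OF convex_nbhd]]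
      of_real_in_nbhd \<epsilon> xy by blast
  ultimately show False using \<delta> by simp
qed

subsection \<open>Contracting holomorphic systems\<close>

text \<open>The family R stands for f'' / f'; that relation enters only in
  \<open>deriv2_comp_list\<close>. The axioms range over all natural numbers as letters, so
  sequences need no side condition and the padding letter 0 is covered.\<close>

locale contracting_system =
  fixes \<epsilon> c :: real and f R :: "nat \<Rightarrow> complex \<Rightarrow> complex"
  assumes eps: "\<epsilon> > 0" and c: "0 \<le> c" "c < 1"
    and f_holo: "f i holomorphic_on nbhd \<epsilon>"
    and f_nbhd: "z \<in> nbhd \<epsilon> \<Longrightarrow> f i z \<in> nbhd \<epsilon>"
    and f_deriv_le: "z \<in> nbhd \<epsilon> \<Longrightarrow> cmod (deriv (f i) z) \<le> c"
    and R_holo: "R i holomorphic_on nbhd \<epsilon>"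
    and R_bounded: "\<exists>B. \<forall>i. \<forall>z\<in>nbhd \<epsilon>. cmod (R i z) \<le> B"
begin

text \<open>The summand of H with number n + 1, arranged to peel off the innermost map first. The
  shift of s then appears in the recursion itself, from which \<open>Hsum_rec\<close> follows
  termwise.\<close>

fun Hterm :: "(nat \<Rightarrow> nat) \<Rightarrow> nat \<Rightarrow> complex \<Rightarrow> complex" where
  "Hterm s 0 z = R (s 0) z"
| "Hterm s (Suc n) z = Hterm (s \<circ> Suc) n (f (s 0) z) * deriv (f (s 0)) z"

definition Hsum :: "(nat \<Rightarrow> nat) \<Rightarrow> complex \<Rightarrow> complex" where
  "Hsum s z = (\<Sum>n. Hterm s n z)"

section \<open>Convergence and holomorphy of the series for H\<close>

lemma Hterm_holo: "Hterm s n holomorphic_on nbhd \<epsilon>"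
proof (induction n arbitrary: s)
  case 0
  then show ?case using R_holo by (simp cong: holomorphic_cong)
next
  case (Suc n)
  have "(Hterm (s \<circ> Suc) n \<circ> f (s 0)) holomorphic_on nbhd \<epsilon>"
    using f_nbhd by (intro holomorphic_on_compose_gen[OF f_holo Suc]) auto
  then have "(\<lambda>z. Hterm (s \<circ> Suc) n (f (s 0) z)) holomorphic_on nbhd \<epsilon>"
    by (simp add: o_def)
  then show ?case
    by (simp add: holomorphic_on_mult holomorphic_deriv[OF f_holo open_nbhd] cong: holomorphic_cong)
qed

text \<open>Each letter contributes one factor c while the orbit stays in S. The choice S =
  \<open>nbhd \<epsilon>\<close> serves uniform convergence; S = [0,1] gives the sharper constant
  \<beta>, which bounds R on the real interval only.\<close>

lemma Hterm_le:
  assumes "S \<subseteq> nbhd \<epsilon>" "\<And>i z. z \<in> S \<Longrightarrow> f i z \<in> S" "\<And>i z. z \<in> S \<Longrightarrow> cmod (R i z) \<le> b" "z \<in> S"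
  shows "cmod (Hterm s n z) \<le> b * c ^ n"
  using assms(4)
proof (induction n arbitrary: s z)
  case (Suc n)
  have "cmod (Hterm (s \<circ> Suc) n (f (s 0) z)) * cmod (deriv (f (s 0)) z) \<le> (b * c ^ n) * c"
    using Suc assms(1-3) f_deriv_le c by (intro mult_mono) (auto intro: order_trans[OF norm_ge_zero])
  then show ?case by (simp add: norm_mult mult_ac)
qed (use assms in simp)

lemma summable_geometric_bound: "summable (\<lambda>n. b * c ^ n)"
  using c by (intro summable_mult summable_geometric) auto

lemma Hterm_le_nbhd: "\<exists>B. \<forall>s n. \<forall>z\<in>nbhd \<epsilon>. cmod (Hterm s n z) \<le> B * c ^ n"
proof -
  obtain B where "\<And>i z. z \<in> nbhd \<epsilon> \<Longrightarrow> cmod (R i z) \<le> B"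
    using R_bounded by blast
  from Hterm_le[of "nbhd \<epsilon>", OF order_refl f_nbhd this] show ?thesis by blast
qed

lemma Hterm_summable:
  assumes "z \<in> nbhd \<epsilon>" shows "summable (\<lambda>n. Hterm s n z)"
proof -
  obtain B where "\<And>s n z. z \<in> nbhd \<epsilon> \<Longrightarrow> cmod (Hterm s n z) \<le> B * c ^ n"
    using Hterm_le_nbhd by blast
  then show ?thesis
    using assms by (intro summable_comparison_test'[OF summable_geometric_bound[of B]])
qed

lemma Hsum_le:
  assumes "S \<subseteq> nbhd \<epsilon>" "\<And>i z. z \<in> S \<Longrightarrow> f i z \<in> S" "\<And>i z. z \<in> S \<Longrightarrow> cmod (R i z) \<le> b" "z \<in> S"
  shows "cmod (Hsum s z) \<le> b / (1 - c)"
proof -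
  have "cmod (Hsum s z) \<le> (\<Sum>n. b * c ^ n)"
    unfolding Hsum_def using Hterm_le[OF assms] by (intro norm_suminf_le summable_geometric_bound)
  also have "\<dots> = b / (1 - c)"
    using c by (subst suminf_mult) (auto simp: suminf_geometric summable_geometric)
  finally show ?thesis .
qed

lemma Hsum_bounded: "\<exists>M\<ge>0. \<forall>s. \<forall>z\<in>nbhd \<epsilon>. cmod (Hsum s z) \<le> M"
proof -
  obtain B where "\<And>i z. z \<in> nbhd \<epsilon> \<Longrightarrow> cmod (R i z) \<le> B"
    using R_bounded by blast
  from Hsum_le[of "nbhd \<epsilon>", OF order_refl f_nbhd this]
  have "\<forall>s. \<forall>z\<in>nbhd \<epsilon>. cmod (Hsum s z) \<le> \<bar>B / (1 - c)\<bar>"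
    by (meson abs_ge_self order_trans)
  then show ?thesis by (meson abs_ge_zero)
qed

lemma Hsum_holo: "Hsum s holomorphic_on nbhd \<epsilon>"
proof (rule holomorphic_uniform_sequence[OF open_nbhd])
  show "(\<lambda>z. \<Sum>k<n. Hterm s k z) holomorphic_on nbhd \<epsilon>" for n
    by (intro holomorphic_on_sum Hterm_holo)
  obtain B where "\<And>s n z. z \<in> nbhd \<epsilon> \<Longrightarrow> cmod (Hterm s n z) \<le> B * c ^ n"
    using Hterm_le_nbhd by blast
  then have ul: "uniform_limit (nbhd \<epsilon>) (\<lambda>n z. \<Sum>k<n. Hterm s k z) (Hsum s) sequentially"
    unfolding Hsum_def by (intro Weierstrass_m_test[OF _ summable_geometric_bound[of B]])
  show "\<exists>d>0. cball z d \<subseteq> nbhd \<epsilon> \<and> uniform_limit (cball z d) (\<lambda>n z. \<Sum>k<n. Hterm s k z) (Hsum s) sequentially"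
    if "z \<in> nbhd \<epsilon>" for z
    using that open_nbhd[of \<epsilon>] uniform_limit_on_subset[OF ul] unfolding open_contains_cball by blast
qed

lemma Hsum_rec:
  assumes "z \<in> nbhd \<epsilon>"
  shows "Hsum s z = R (s 0) z + Hsum (s \<circ> Suc) (f (s 0) z) * deriv (f (s 0)) z"
proof -
  have "Hsum s z = Hterm s 0 z + (\<Sum>n. Hterm s (Suc n) z)"
    unfolding Hsum_def using suminf_split_head[OF Hterm_summable[OF assms]] by simp
  also have "(\<Sum>n. Hterm s (Suc n) z) = Hsum (s \<circ> Suc) (f (s 0) z) * deriv (f (s 0)) z"
    unfolding Hsum_def using suminf_mult2[OF Hterm_summable[OF f_nbhd[OF assms]]] by simp
  finally show ?thesis by simp
qed

lemma Hterm_eq_0: "(\<And>z. R (s n) z = 0) \<Longrightarrow> Hterm s n z = 0"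
  by (induction n arbitrary: s z) auto

section \<open>Compositions along finite words, innermost letter first\<close>

fun comp_list :: "nat list \<Rightarrow> complex \<Rightarrow> complex" where
  "comp_list [] z = z"
| "comp_list (i # l) z = comp_list l (f i z)"

lemma comp_list_nbhd: "z \<in> nbhd \<epsilon> \<Longrightarrow> comp_list l z \<in> nbhd \<epsilon>"
  by (induction l arbitrary: z) (auto intro: f_nbhd)

lemma comp_list_holo: "comp_list l holomorphic_on nbhd \<epsilon>"
proof (induction l)
  case (Cons i l)
  have "(comp_list l \<circ> f i) holomorphic_on nbhd \<epsilon>"
    using f_nbhd by (intro holomorphic_on_compose_gen[OF f_holo Cons]) auto
  then show ?case by (simp add: o_def cong: holomorphic_cong)
qed (simp cong: holomorphic_cong)

lemma deriv_comp_list_Cons: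
  assumes "z \<in> nbhd \<epsilon>"
  shows "deriv (comp_list (i # l)) z = deriv (comp_list l) (f i z) * deriv (f i) z"
proof -
  have "comp_list (i # l) = comp_list l \<circ> f i" by (simp add: fun_eq_iff)
  moreover have "f i field_differentiable at z" "comp_list l field_differentiable at (f i z)"
    using assms f_nbhd f_holo comp_list_holo open_nbhd holomorphic_on_imp_differentiable_at by blast+
  ultimately show ?thesis by (simp only: deriv_chain)
qed

lemma deriv_comp_list_le_1: "z \<in> nbhd \<epsilon> \<Longrightarrow> cmod (deriv (comp_list l) z) \<le> 1"
proof (induction l arbitrary: z)
  case (Cons i l)
  have "cmod (deriv (comp_list l) (f i z)) * cmod (deriv (f i) z) \<le> 1 * 1"
    using Cons f_nbhd f_deriv_le[of z i] c by (intro mult_mono) auto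
  then show ?case using Cons by (simp add: deriv_comp_list_Cons norm_mult del: comp_list.simps)
next
  case Nil
  have "comp_list [] = (\<lambda>z. z)" by (simp add: fun_eq_iff)
  then show ?case by simp
qed

lemma deriv_comp_list_ge:
  assumes "\<And>i z. i \<in> A \<Longrightarrow> z \<in> nbhd \<epsilon> \<Longrightarrow> m \<le> cmod (deriv (f i) z)" "0 \<le> m" "set l \<subseteq> A" "z \<in> nbhd \<epsilon>"
  shows "m ^ length l \<le> cmod (deriv (comp_list l) z)"
  using assms(3,4)
proof (induction l arbitrary: z)
  case (Cons i l)
  have "m ^ length l * m \<le> cmod (deriv (comp_list l) (f i z)) * cmod (deriv (f i) z)"
    using Cons f_nbhd assms by (intro mult_mono) auto
  then show ?case using Cons by (simp add: deriv_comp_list_Cons norm_mult mult_ac del: comp_list.simps)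
next
  case Nil
  have "comp_list [] = (\<lambda>z. z)" by (simp add: fun_eq_iff)
  then show ?case by simp
qed

text \<open>The default letter 0 adds nothing to \<open>Hsum\<close> when \<open>R 0\<close>
  vanishes identically, as \<open>deriv2_comp_list\<close> assumes.\<close>

definition pad :: "nat list \<Rightarrow> nat \<Rightarrow> nat" where
  "pad l k = (if k < length l then l ! k else 0)"

lemma pad_Cons: "pad (i # l) 0 = i" "pad (i # l) \<circ> Suc = pad l"
  by (auto simp: pad_def fun_eq_iff)

text \<open>The derivative of \<open>log F'\<close> along a composition \<open>F\<close> is an additive cocycle; \<open>H\<close> is its sum.\<close>

lemma deriv2_comp_list:
  assumes "\<And>z. R 0 z = 0"
    and "\<And>i z. i \<in> set l \<Longrightarrow> z \<in> nbhd \<epsilon> \<Longrightarrow> deriv (deriv (f i)) z = R i z * deriv (f i) z"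
    and "z \<in> nbhd \<epsilon>"
  shows "deriv (deriv (comp_list l)) z = Hsum (pad l) z * deriv (comp_list l) z"
  using assms(2,3)
proof (induction l arbitrary: z)
  case Nil
  have "comp_list [] = (\<lambda>z. z)" by (simp add: fun_eq_iff)
  moreover have "Hterm (pad []) n z = 0" for n
    by (rule Hterm_eq_0) (simp add: pad_def assms)
  ultimately show ?case by (simp add: Hsum_def)
next
  case (Cons i l)
  have "((\<lambda>z. deriv (comp_list l) (f i z) * deriv (f i) z) has_field_derivative
      deriv (comp_list l) (f i z) * deriv (deriv (f i)) z +
      deriv (deriv (comp_list l)) (f i z) * deriv (f i) z * deriv (f i) z) (at z)"
    by (intro DERIV_mult' DERIV_chain2[where f="deriv (comp_list l)"] holomorphic_derivI[OF _ open_nbhd[of \<epsilon>]]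
        holomorphic_deriv f_holo comp_list_holo open_nbhd f_nbhd Cons.prems)
  then have "deriv (\<lambda>z. deriv (comp_list l) (f i z) * deriv (f i) z) z =
      deriv (comp_list l) (f i z) * deriv (deriv (f i)) z +
      deriv (deriv (comp_list l)) (f i z) * deriv (f i) z * deriv (f i) z"
    by (rule DERIV_imp_deriv)
  \<comment> \<open>The chain rule holds on a whole neighbourhood of z and may therefore be
    differentiated.\<close>
  moreover have "deriv (deriv (comp_list (i # l))) z = deriv (\<lambda>z. deriv (comp_list l) (f i z) * deriv (f i) z) z"
  proof (rule deriv_cong_ev[OF _ refl])
    show "\<forall>\<^sub>F z in nhds z. deriv (comp_list (i # l)) z = deriv (comp_list l) (f i z) * deriv (f i) z"
      using eventually_nhds_in_open[OF open_nbhd Cons.prems(2)]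
      by eventually_elim (rule deriv_comp_list_Cons)
  qed
  moreover have "deriv (deriv (comp_list l)) (f i z) = Hsum (pad l) (f i z) * deriv (comp_list l) (f i z)"
    using Cons f_nbhd by auto
  ultimately show ?case
    using Cons.prems
    by (simp add: deriv_comp_list_Cons Hsum_rec[of z "pad (i # l)"] pad_Cons algebra_simps del: comp_list.simps)
qed

end

subsection \<open>Analytic iterated function systems\<close>

text \<open>Near x the function G, restricted to the real axis, is a real-valued curve. Its vector
  derivative is the complex derivative of G, whose imaginary part must then be 0 and whose real part
  is the derivative of g.\<close>

lemma deriv_of_real_restriction:
  assumes "G holomorphic_on S" "open S" "\<And>x::real. of_real x \<in> S \<Longrightarrow> G (of_real x) = of_real (g x)"
    and "of_real x \<in> S"
  shows "(g has_real_derivative deriv g x) (at x)" "deriv G (of_real x) = complex_of_real (deriv g x)"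
proof -
  define D where "D = deriv G (of_real x)"
  have "(G has_field_derivative D) (at (of_real x))"
    unfolding D_def by (rule holomorphic_derivI[OF assms(1,2,4)])
  then have "((\<lambda>t. G (of_real t)) has_vector_derivative D) (at x)"
    by (rule has_vector_derivative_real_field)
  moreover have "open (complex_of_real -` S)"
    by (intro open_vimage assms continuous_intros)
  ultimately have D: "((\<lambda>t. complex_of_real (g t)) has_vector_derivative D) (at x)"
    by (rule has_vector_derivative_transform_within_open) (use assms(3,4) in auto)
  have "(g has_vector_derivative Re D) (at x)"
    using bounded_linear.has_vector_derivative[OF bounded_linear_Re D] by simp
  then have g: "(g has_real_derivative Re D) (at x)"
    by (simp add: has_real_derivative_iff_has_vector_derivative)
  have "((\<lambda>t. 0 :: real) has_vector_derivative Im D) (at x)"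
    using bounded_linear.has_vector_derivative[OF bounded_linear_Im D] by simp
  then have "Im D = 0"
    by (rule vector_derivative_unique_at) simp
  moreover have "deriv g x = Re D" using g by (rule DERIV_imp_deriv)
  ultimately show "(g has_real_derivative deriv g x) (at x)" "deriv G (of_real x) = complex_of_real (deriv g x)"
    using g by (simp_all add: D_def complex_eq_iff)
qed

lemma comp_word_append: "comp_word \<Phi> (u @ v) = comp_word \<Phi> u \<circ> comp_word \<Phi> v"
  by (induction u) (auto simp: o_assoc)

locale analytic_ifs =
  fixes \<epsilon> :: real and N :: nat and \<Phi> :: "nat \<Rightarrow> real \<Rightarrow> real"
  assumes eps_pos: "\<epsilon> > 0" and N_pos: "N \<ge> 1" and IFS: "\<Phi> \<in> IFS \<epsilon> N"
begin

text \<open>The letter 0 pads finite words to infinite ones. It stands for a constant map, for which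
  \<open>f'' / f' = 0 / 0 = 0\<close>, so padding does not change \<open>H\<close>.\<close>

definition fc :: "nat \<Rightarrow> complex \<Rightarrow> complex" where
  "fc i = (if i \<in> {1..N} then cext \<epsilon> (\<Phi> i) else (\<lambda>_. 0))"

definition Rc :: "nat \<Rightarrow> complex \<Rightarrow> complex" where
  "Rc i z = deriv (deriv (fc i)) z / deriv (fc i) z"

abbreviation c :: real where "c \<equiv> c_max \<epsilon> N \<Phi>"

section \<open>Holomorphy and uniform bounds of the extended maps\<close>

lemma S_omega: "i \<in> {1..N} \<Longrightarrow> \<Phi> i \<in> S_omega \<epsilon>"
  using IFS unfolding IFS_def by blast

lemma fc_pad: "i \<notin> {1..N} \<Longrightarrow> fc i = (\<lambda>_. 0)" "i \<notin> {1..N} \<Longrightarrow> Rc i z = 0"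
  unfolding Rc_def fc_def by (simp_all del: atLeastAtMost_iff)

lemma is_cext_fc:
  assumes "i \<in> {1..N}" shows "is_cext \<epsilon> (\<Phi> i) (fc i)"
proof -
  have "\<exists>F. is_cext \<epsilon> (\<Phi> i) F" using S_omega[OF assms] unfolding S_omega_def by blast
  then have "is_cext \<epsilon> (\<Phi> i) (cext \<epsilon> (\<Phi> i))" unfolding cext_def by (rule someI_ex)
  then show ?thesis using assms by (simp add: fc_def)
qed

lemma fc_holo2: "i \<in> {1..N} \<Longrightarrow> fc i holomorphic_on nbhd (2 * \<epsilon>)"
  using is_cext_fc unfolding is_cext_def by (blast intro: analytic_imp_holomorphic)

lemma fc_of_real2: "i \<in> {1..N} \<Longrightarrow> of_real x \<in> nbhd (2 * \<epsilon>) \<Longrightarrow> fc i (of_real x) = of_real (\<Phi> i x)"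
  using is_cext_fc unfolding is_cext_def by blast

lemma fc_closure:
  assumes "i \<in> {1..N}" "z \<in> closure (nbhd \<epsilon>)"
  shows "fc i z \<in> nbhd \<epsilon>" "deriv (fc i) z \<noteq> 0" "cmod (deriv (fc i) z) < 1"
  using S_omega[OF assms(1)] assms unfolding S_omega_def fc_def by auto

lemma Phi_unit: "i \<in> {1..N} \<Longrightarrow> x \<in> {0..1} \<Longrightarrow> \<Phi> i x \<in> {0..1}"
  using S_omega unfolding S_omega_def by blast

lemma fc_derivs_continuous:
  assumes "i \<in> {1..N}"
  shows "continuous_on (closure (nbhd \<epsilon>)) (\<lambda>z. cmod (deriv (fc i) z))"
    "continuous_on (closure (nbhd \<epsilon>)) (\<lambda>z. cmod (Rc i z))"
proof -
  have "deriv (fc i) holomorphic_on nbhd (2 * \<epsilon>)" "deriv (deriv (fc i)) holomorphic_on nbhd (2 * \<epsilon>)"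
    using fc_holo2[OF assms] by (auto intro!: holomorphic_deriv open_nbhd)
  then have *: "continuous_on (closure (nbhd \<epsilon>)) (deriv (fc i))"
      "continuous_on (closure (nbhd \<epsilon>)) (deriv (deriv (fc i)))"
    using closure_nbhd_subset[OF eps_pos] holomorphic_on_imp_continuous_on continuous_on_subset by blast+
  then show "continuous_on (closure (nbhd \<epsilon>)) (\<lambda>z. cmod (deriv (fc i) z))"
    "continuous_on (closure (nbhd \<epsilon>)) (\<lambda>z. cmod (Rc i z))"
    unfolding Rc_def using fc_closure(2)[OF assms] by (auto intro!: continuous_intros)
qed

lemma nonempty: "closure (nbhd \<epsilon>) \<noteq> {}" "{1..N} \<noteq> {}"
  using of_real_in_nbhd[OF eps_pos, of 0] N_pos by auto

lemma deriv_fc_le_c: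
  assumes "i \<in> {1..N}" "z \<in> closure (nbhd \<epsilon>)"
  shows "cmod (deriv (fc i) z) \<le> c"
proof -
  have "bdd_above ((\<lambda>(z, i). cmod (deriv (cext \<epsilon> (\<Phi> i)) z)) ` (closure (nbhd \<epsilon>) \<times> {1..N}))"
    using fc_closure(3) by (fastforce intro!: bdd_aboveI2[where M=1] simp: fc_def)
  from cSUP_upper2[OF this, of "(z, i)"] show ?thesis
    using assms unfolding c_max_def by (auto simp: fc_def)
qed

text \<open>The derivatives are below 1 only pointwise. On the compact closure each letter attains
  its maximum, and finitely many letters leave a maximum m < 1 above the supremum.\<close>

lemma c_bounds: "0 \<le> c" "c < 1"
proof -
  show "0 \<le> c"
    using deriv_fc_le_c nonempty by (meson ex_in_conv norm_ge_zero order_trans)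
  have "\<exists>y\<in>closure (nbhd \<epsilon>). \<forall>z\<in>closure (nbhd \<epsilon>). cmod (deriv (fc i) z) \<le> cmod (deriv (fc i) y)"
    if "i \<in> {1..N}" for i
    by (rule continuous_attains_sup[OF compact_closure_nbhd nonempty(1) fc_derivs_continuous(1)[OF that]])
  then obtain y where y: "\<And>i. i \<in> {1..N} \<Longrightarrow> y i \<in> closure (nbhd \<epsilon>)"
    "\<And>i z. i \<in> {1..N} \<Longrightarrow> z \<in> closure (nbhd \<epsilon>) \<Longrightarrow> cmod (deriv (fc i) z) \<le> cmod (deriv (fc i) (y i))"
    by metis
  define m where "m = Max ((\<lambda>i. cmod (deriv (fc i) (y i))) ` {1..N})"
  have "c \<le> m" unfolding c_max_def
  proof (rule cSUP_least)
    fix p assume "p \<in> closure (nbhd \<epsilon>) \<times> {1..N}"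
    then obtain z i where p: "p = (z, i)" "z \<in> closure (nbhd \<epsilon>)" "i \<in> {1..N}" by auto
    have "cmod (deriv (fc i) z) \<le> m" unfolding m_def
      using y(2)[OF p(3,2)] p(3) by (intro Max.coboundedI[THEN order_trans[rotated]]) auto
    then show "(case p of (z, i) \<Rightarrow> cmod (deriv (cext \<epsilon> (\<Phi> i)) z)) \<le> m"
      using p by (simp add: fc_def)
  qed (use nonempty in auto)
  also have "m < 1" unfolding m_def
    using nonempty(2) y(1) fc_closure(3) by (subst Max_less_iff) auto
  finally show "c < 1" .
qed

text \<open>Compactness again, now for minima. The constant m limits how fast the images of [0,1]
  and the derivatives of compositions can shrink.\<close>

lemma deriv_fc_ge: "\<exists>m>0. \<forall>i\<in>{1..N}. \<forall>z\<in>closure (nbhd \<epsilon>). m \<le> cmod (deriv (fc i) z)"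
proof -
  have "\<exists>y\<in>closure (nbhd \<epsilon>). \<forall>z\<in>closure (nbhd \<epsilon>). cmod (deriv (fc i) y) \<le> cmod (deriv (fc i) z)"
    if "i \<in> {1..N}" for i
    by (rule continuous_attains_inf[OF compact_closure_nbhd nonempty(1) fc_derivs_continuous(1)[OF that]])
  then obtain y where y: "\<And>i. i \<in> {1..N} \<Longrightarrow> y i \<in> closure (nbhd \<epsilon>)"
    "\<And>i z. i \<in> {1..N} \<Longrightarrow> z \<in> closure (nbhd \<epsilon>) \<Longrightarrow> cmod (deriv (fc i) (y i)) \<le> cmod (deriv (fc i) z)"
    by metis
  define m where "m = Min ((\<lambda>i. cmod (deriv (fc i) (y i))) ` {1..N})"
  have "m > 0" unfolding m_def
    using nonempty(2) y(1) fc_closure(2) by (subst Min_gr_iff) auto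
  moreover have "m \<le> cmod (deriv (fc i) z)" if "i \<in> {1..N}" "z \<in> closure (nbhd \<epsilon>)" for i z
    using y(2)[OF that] that unfolding m_def by (intro order_trans[OF Min.coboundedI]) auto
  ultimately show ?thesis by blast
qed

lemma Rc_bounded: "\<exists>B. \<forall>i. \<forall>z\<in>closure (nbhd \<epsilon>). cmod (Rc i z) \<le> B"
proof -
  have "\<exists>y\<in>closure (nbhd \<epsilon>). \<forall>z\<in>closure (nbhd \<epsilon>). cmod (Rc i z) \<le> cmod (Rc i y)"
    if "i \<in> {1..N}" for i
    by (rule continuous_attains_sup[OF compact_closure_nbhd nonempty(1) fc_derivs_continuous(2)[OF that]])
  then obtain y where y:
    "\<And>i z. i \<in> {1..N} \<Longrightarrow> z \<in> closure (nbhd \<epsilon>) \<Longrightarrow> cmod (Rc i z) \<le> cmod (Rc i (y i))"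
    by metis
  have "cmod (Rc i z) \<le> (\<Sum>i=1..N. cmod (Rc i (y i)))" if "z \<in> closure (nbhd \<epsilon>)" for i z
  proof (cases "i \<in> {1..N}")
    case True
    have "cmod (Rc i (y i)) \<le> (\<Sum>i=1..N. cmod (Rc i (y i)))"
      using True by (intro member_le_sum) auto
    with y[OF True that] show ?thesis by linarith
  next
    case False
    then show ?thesis by (simp add: fc_pad sum_nonneg)
  qed
  then show ?thesis by blast
qed

text \<open>For the letters outside {1..N} the axioms hold because the constant value 0 lies in
  [0,1] and both the derivative and \<open>Rc\<close> are 0.\<close>

sublocale contracting_system \<epsilon> c fc Rc
proof
  fix i
  show "fc i holomorphic_on nbhd \<epsilon>"
    using fc_holo2[of i] closure_subset[of "nbhd \<epsilon>"] closure_nbhd_subset[OF eps_pos] fc_pad(1)[of i]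
    by (cases "i \<in> {1..N}") (auto intro: holomorphic_on_subset)
  then have "deriv (fc i) holomorphic_on nbhd \<epsilon>" "deriv (deriv (fc i)) holomorphic_on nbhd \<epsilon>"
    by (auto intro!: holomorphic_deriv open_nbhd)
  then have "Rc i holomorphic_on nbhd \<epsilon>" if "i \<in> {1..N}"
    unfolding Rc_def[abs_def] using fc_closure(2)[OF that] closure_subset
    by (intro holomorphic_on_divide) auto
  moreover have "Rc i = (\<lambda>_. 0)" if "i \<notin> {1..N}"
    using fc_pad(2)[OF that] by (simp add: fun_eq_iff)
  ultimately show "Rc i holomorphic_on nbhd \<epsilon>"
    by (cases "i \<in> {1..N}") (auto simp del: atLeastAtMost_iff)
  show "\<exists>B. \<forall>i. \<forall>z\<in>nbhd \<epsilon>. cmod (Rc i z) \<le> B"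
    using Rc_bounded closure_subset[of "nbhd \<epsilon>"] by (meson subsetD)
  fix z assume z: "z \<in> nbhd \<epsilon>"
  show "fc i z \<in> nbhd \<epsilon>"
    using z fc_closure(1)[of i z] closure_subset[of "nbhd \<epsilon>"] of_real_in_nbhd[OF eps_pos, of 0] fc_pad(1)[of i]
    by (cases "i \<in> {1..N}") auto
  show "cmod (deriv (fc i) z) \<le> c"
    using z deriv_fc_le_c[of i z] closure_subset[of "nbhd \<epsilon>"] fc_pad(1)[of i] c_bounds
    by (cases "i \<in> {1..N}") auto
qed (use eps_pos c_bounds in auto)

section \<open>Passage between the complex extensions and the real maps\<close>

lemma real_derivs:
  assumes "i \<in> {1..N}" "x \<in> {0..1}"
  shows "(\<Phi> i has_real_derivative deriv (\<Phi> i) x) (at x)"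
    "deriv (fc i) (of_real x) = of_real (deriv (\<Phi> i) x)"
    "deriv (deriv (fc i)) (of_real x) = of_real (deriv (deriv (\<Phi> i)) x)"
proof -
  have x: "complex_of_real x \<in> nbhd (2 * \<epsilon>)" using assms eps_pos by (intro of_real_in_nbhd) auto
  note 1 = deriv_of_real_restriction[OF fc_holo2[OF assms(1)] open_nbhd fc_of_real2[OF assms(1)]]
  show "(\<Phi> i has_real_derivative deriv (\<Phi> i) x) (at x)" "deriv (fc i) (of_real x) = of_real (deriv (\<Phi> i) x)"
    using 1 x by auto
  show "deriv (deriv (fc i)) (of_real x) = of_real (deriv (deriv (\<Phi> i)) x)"
    using deriv_of_real_restriction(2)[OF holomorphic_deriv[OF fc_holo2[OF assms(1)] open_nbhd] open_nbhd 1(2) x]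
    by blast
qed

lemma fc_of_real: "i \<in> {1..N} \<Longrightarrow> x \<in> {0..1} \<Longrightarrow> fc i (of_real x) = of_real (\<Phi> i x)"
  using fc_of_real2 of_real_in_nbhd eps_pos by simp

lemma Rc_of_real:
  assumes "i \<in> {1..N}" "x \<in> {0..1}"
  shows "Rc i (of_real x) = of_real (deriv (deriv (\<Phi> i)) x / deriv (\<Phi> i) x)"
  unfolding Rc_def using real_derivs(2,3)[OF assms] by simp

lemma comp_word_unit: "set u \<subseteq> {1..N} \<Longrightarrow> x \<in> {0..1} \<Longrightarrow> comp_word \<Phi> u x \<in> {0..1}"
  using Phi_unit by (induction u) (simp_all del: atLeastAtMost_iff)

lemma comp_word_Cons_deriv:
  assumes "i \<in> {1..N}" "set u \<subseteq> {1..N}" "x \<in> {0..1}"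
    "(comp_word \<Phi> u has_real_derivative D) (at x)"
  shows "(comp_word \<Phi> (i # u) has_real_derivative deriv (\<Phi> i) (comp_word \<Phi> u x) * D) (at x)"
  using DERIV_chain[OF real_derivs(1)[OF assms(1) comp_word_unit[OF assms(2,3)]] assms(4)] by simp

lemma comp_word_has_deriv:
  assumes "set u \<subseteq> {1..N}" "x \<in> {0..1}"
  shows "(comp_word \<Phi> u has_real_derivative deriv (comp_word \<Phi> u) x) (at x)"
proof -
  have "\<exists>D. (comp_word \<Phi> u has_real_derivative D) (at x)"
    using assms
  proof (induction u)
    case Nil
    then show ?case by (auto intro: DERIV_ident simp: id_def)
  next
    case (Cons i u)
    then obtain D where "(comp_word \<Phi> u has_real_derivative D) (at x)" by auto
    with Cons.prems have "(comp_word \<Phi> (i # u) has_real_derivative deriv (\<Phi> i) (comp_word \<Phi> u x) * D) (at x)"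
      by (intro comp_word_Cons_deriv) (simp_all del: comp_word.simps)
    then show ?case by blast
  qed
  then show ?thesis by (metis DERIV_imp_deriv)
qed

lemma comp_word_deriv_ge:
  assumes m: "\<forall>i\<in>{1..N}. \<forall>z\<in>closure (nbhd \<epsilon>). m \<le> cmod (deriv (fc i) z)" "0 \<le> m"
    and "set u \<subseteq> {1..N}" "x \<in> {0..1}"
  shows "m ^ length u \<le> \<bar>deriv (comp_word \<Phi> u) x\<bar>"
  using assms(3,4)
proof (induction u)
  case Nil
  then show ?case by (simp add: id_def)
next
  case (Cons i u)
  then have i: "i \<in> {1..N}" and u: "set u \<subseteq> {1..N}" by auto
  define y where "y = comp_word \<Phi> u x"
  have y: "y \<in> {0..1}" using comp_word_unit[OF u Cons.prems(2)] by (simp add: y_def)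
  have "m \<le> cmod (deriv (fc i) (of_real y))"
    using m i of_real_in_nbhd[OF eps_pos y] closure_subset[of "nbhd \<epsilon>"] by auto
  then have "m \<le> \<bar>deriv (\<Phi> i) y\<bar>"
    using real_derivs(2)[OF i y] by simp
  then have "m * m ^ length u \<le> \<bar>deriv (\<Phi> i) y\<bar> * \<bar>deriv (comp_word \<Phi> u) x\<bar>"
    using Cons u m(2) by (intro mult_mono) auto
  moreover have "deriv (comp_word \<Phi> (i # u)) x = deriv (\<Phi> i) y * deriv (comp_word \<Phi> u) x"
    unfolding y_def by (intro DERIV_imp_deriv comp_word_Cons_deriv comp_word_has_deriv i u Cons.prems)
  ultimately show ?case by (simp add: abs_mult del: comp_word.simps)
qed

text \<open>The mean value theorem puts the images of 0 and 1 at distance at least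
  \<open>m ^ length u\<close>, and connectedness of the image fills the interval between
  them.\<close>

lemma comp_word_image_interval:
  assumes m: "\<forall>i\<in>{1..N}. \<forall>z\<in>closure (nbhd \<epsilon>). m \<le> cmod (deriv (fc i) z)" "0 \<le> m"
    and u: "set u \<subseteq> {1..N}"
  shows "\<exists>a b. 0 \<le> a \<and> b \<le> 1 \<and> m ^ length u \<le> b - a \<and> {a..b} \<subseteq> comp_word \<Phi> u ` {0..1}"
proof -
  let ?h = "comp_word \<Phi> u"
  have "\<exists>z>0. z < 1 \<and> ?h 1 - ?h 0 = (1 - 0) * deriv ?h z"
    by (rule MVT2) (auto intro: comp_word_has_deriv[OF u])
  then have gap: "m ^ length u \<le> \<bar>?h 1 - ?h 0\<bar>"
    using comp_word_deriv_ge[OF m u] by auto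
  have "continuous_on {0..1} ?h"
    using comp_word_has_deriv[OF u] by (meson DERIV_isCont continuous_at_imp_continuous_on)
  then have conn: "connected (?h ` {0..1})"
    by (intro connected_continuous_image) auto
  have "?h 0 \<in> {0..1}" "?h 1 \<in> {0..1}" using comp_word_unit[OF u] by auto
  moreover have "{min (?h 0) (?h 1)..max (?h 0) (?h 1)} \<subseteq> ?h ` {0..1}"
    by (intro connected_contains_Icc[OF conn]) (auto simp: min_def max_def)
  ultimately show ?thesis
    using gap by (intro exI[of _ "min (?h 0) (?h 1)"] exI[of _ "max (?h 0) (?h 1)"]) auto
qed

section \<open>Agreement of the complex series with the real function \<open>H\<close>\<close>

lemma Hterm_of_real:
  assumes "\<And>k. k \<le> n \<Longrightarrow> s k \<in> {1..N}" "x \<in> {0..1}"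
  defines "g \<equiv> comp_word \<Phi> (rev (map s [0..<n]))"
  shows "Hterm s n (of_real x) =
    of_real (deriv (deriv (\<Phi> (s n))) (g x) / deriv (\<Phi> (s n)) (g x) * deriv g x)"
  using assms(1,2) unfolding g_def
proof (induction n arbitrary: s x)
  case 0
  then show ?case by (simp add: Rc_of_real id_def)
next
  case (Suc n)
  define h where "h = comp_word \<Phi> (rev (map (s \<circ> Suc) [0..<n]))"
  have s0: "s 0 \<in> {1..N}" using Suc.prems by auto
  have sub: "set (rev (map (s \<circ> Suc) [0..<n])) \<subseteq> {1..N}" using Suc.prems(1) by (force simp del: atLeastAtMost_iff)
  have y: "\<Phi> (s 0) x \<in> {0..1}" by (rule Phi_unit[OF s0 Suc.prems(2)])
  \<comment> \<open>The innermost letter \<open>s 0\<close> ends the reversed prefix, so it splits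
    off on the right and the chain rule matches the recursion of \<open>Hterm\<close>.\<close>
  have "rev (map s [0..<Suc n]) = rev (map (s \<circ> Suc) [0..<n]) @ [s 0]"
    unfolding map_upt_Suc by (simp add: o_def)
  then have g: "comp_word \<Phi> (rev (map s [0..<Suc n])) = h \<circ> \<Phi> (s 0)"
    by (simp add: comp_word_append h_def del: upt_Suc)
  have "deriv (h \<circ> \<Phi> (s 0)) x = deriv h (\<Phi> (s 0) x) * deriv (\<Phi> (s 0)) x"
    unfolding h_def
    by (intro DERIV_imp_deriv DERIV_chain comp_word_has_deriv[OF sub y] real_derivs(1)[OF s0 Suc.prems(2)])
  moreover have "Hterm (s \<circ> Suc) n (of_real (\<Phi> (s 0) x)) =
    of_real (deriv (deriv (\<Phi> ((s \<circ> Suc) n))) (h (\<Phi> (s 0) x)) / deriv (\<Phi> ((s \<circ> Suc) n)) (h (\<Phi> (s 0) x)) * deriv h (\<Phi> (s 0) x))"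
    unfolding h_def by (rule Suc.IH) (use Suc.prems y in auto)
  ultimately show ?case
    unfolding g using fc_of_real[OF s0 Suc.prems(2)] real_derivs(2)[OF s0 Suc.prems(2)] by (simp add: mult_ac del: o_apply) (simp add: mult_ac)
qed

text \<open>Letters of a word are numbered from 1, the sequences in \<open>Hsum\<close> from 0.
  Padding turns finite and infinite words alike into such sequences.\<close>

definition padded :: "word \<Rightarrow> nat \<Rightarrow> nat" where
  "padded w k = (if enat (Suc k) \<le> word_length w then letter w (Suc k) else 0)"

lemma Hterm_padded:
  assumes "w \<in> words N" "enat (Suc n) \<le> word_length w" "x \<in> {0..1}"
  shows "Hterm (padded w) n (of_real x) = of_real (H_term \<Phi> w (Suc n) x)"
proof -
  have le: "enat (Suc k) \<le> word_length w" if "k \<le> n" for k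
    using that assms(2) by (meson Suc_le_mono enat_ord_simps(1) order_trans)
  have p: "padded w k = letter w (Suc k)" if "k \<le> n" for k
    using le[OF that] by (simp add: padded_def)
  have "rev_prefix w n = rev (map (padded w) [0..<n])"
    unfolding rev_prefix_def using p by (simp add: map_Suc_upt[symmetric] del: map_Suc_upt upt_Suc)
  moreover have "padded w k \<in> {1..N}" if "k \<le> n" for k
    using assms(1) le[OF that] p[OF that] unfolding words_def by auto
  ultimately show ?thesis
    using Hterm_of_real[of n "padded w" x] assms(3) p by (simp add: H_term_def Let_def)
qed

lemma Hsum_padded:
  assumes "w \<in> words N" "x \<in> {0..1}"
  shows "Hsum (padded w) (of_real x) = of_real (H \<Phi> w x)"
proof (cases w)
  case (Fin_word u)
  have "Hterm (padded w) n z = 0" if "length u \<le> n" for n z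
    using that Fin_word by (intro Hterm_eq_0 fc_pad) (simp add: padded_def)
  then have "Hsum (padded w) (of_real x) = (\<Sum>n<length u. Hterm (padded w) n (of_real x))"
    unfolding Hsum_def by (intro suminf_finite) auto
  also have "\<dots> = (\<Sum>n<length u. of_real (H_term \<Phi> w (Suc n) x))"
    using assms Fin_word by (intro sum.cong refl Hterm_padded) auto
  also have "\<dots> = of_real (H \<Phi> w x)"
    using Fin_word by (simp add: H_def sum.atLeast1_atMost_eq)
  finally show ?thesis .
next
  case (Inf_word s)
  have eq: "Hterm (padded w) n (of_real x) = of_real (H_term \<Phi> w (Suc n) x)" for n
    using assms Inf_word by (intro Hterm_padded) auto
  then have "summable (\<lambda>n. H_term \<Phi> w (Suc n) x)"
    using Hterm_summable[OF of_real_in_nbhd[OF eps_pos assms(2)], of "padded w"]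
    by (simp add: summable_of_real_iff)
  then show ?thesis
    unfolding Hsum_def eq using Inf_word by (simp add: H_def suminf_of_real)
qed

section \<open>Separation of the functions H for distinct words\<close>

lemma Hsum_gap:
  assumes \<beta>: "\<And>i x. i \<in> {1..N} \<Longrightarrow> x \<in> {0..1} \<Longrightarrow> \<bar>deriv (deriv (\<Phi> i)) x / deriv (\<Phi> i) x\<bar> \<le> \<beta>"
    and st: "s 0 \<in> {1..N}" "t 0 \<in> {1..N}" and x: "x \<in> {0..1}"
    and \<alpha>: "\<alpha> \<le> \<bar>deriv (deriv (\<Phi> (s 0))) x / deriv (\<Phi> (s 0)) x - deriv (deriv (\<Phi> (t 0))) x / deriv (\<Phi> (t 0)) x\<bar>"
  shows "\<alpha> - 2 * \<beta> * c / (1 - c) \<le> cmod (Hsum s (of_real x) - Hsum t (of_real x))"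
proof -
  have \<beta>0: "0 \<le> \<beta>" using \<beta>[OF st(1) x] by linarith
  have S: "complex_of_real ` {0..1} \<subseteq> nbhd \<epsilon>" using of_real_in_nbhd[OF eps_pos] by blast
  \<comment> \<open>The real interval is invariant under every letter, padding included, so
    \<open>Hsum_le\<close> applies there with the constant \<beta>.\<close>
  have inv: "fc i z \<in> complex_of_real ` {0..1} \<and> cmod (Rc i z) \<le> \<beta>"
    if z: "z \<in> complex_of_real ` {0..1}" for i z
  proof (cases "i \<in> {1..N}")
    case True
    obtain y where y: "y \<in> {0..1}" "z = of_real y" using z by blast
    show ?thesis
      unfolding y(2) fc_of_real[OF True y(1)] Rc_of_real[OF True y(1)] norm_of_real
      using Phi_unit[OF True y(1)] \<beta>[OF True y(1)] by blast
  next
    case False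
    have "(0::complex) = of_real 0" by simp
    then have "(0::complex) \<in> of_real ` {0..1}" by (rule image_eqI) simp
    then show ?thesis unfolding fc_pad(1)[OF False] fc_pad(2)[OF False] using \<beta>0 by simp
  qed
  have xz: "complex_of_real x \<in> nbhd \<epsilon>" using S x by blast
  \<comment> \<open>All terms after the first carry the derivative of the first map, which accounts
    for the extra factor c. Two such tails make up the loss in the claimed gap.\<close>
  have tail: "cmod (Hsum (s \<circ> Suc) (fc (s 0) (of_real x)) * deriv (fc (s 0)) (of_real x)) \<le> \<beta> / (1 - c) * c" for s
    unfolding norm_mult using x \<beta>0 c_bounds
    by (intro mult_mono Hsum_le[OF S] conjunct1[OF inv] conjunct2[OF inv] f_deriv_le xz) auto
  have tri: "cmod a - (cmod u + cmod v) \<le> cmod (a + u - v)" for a u v :: complex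
    by (smt (verit) norm_diff_ineq norm_triangle_ineq2)
  define a where "a = Rc (s 0) (of_real x) - Rc (t 0) (of_real x)"
  define u where "u = Hsum (s \<circ> Suc) (fc (s 0) (of_real x)) * deriv (fc (s 0)) (of_real x)"
  define v where "v = Hsum (t \<circ> Suc) (fc (t 0) (of_real x)) * deriv (fc (t 0)) (of_real x)"
  have eq: "Hsum s (of_real x) - Hsum t (of_real x) = a + u - v"
    unfolding Hsum_rec[OF xz, of s] Hsum_rec[OF xz, of t] a_def u_def v_def by simp
  have "\<alpha> \<le> cmod a"
    using \<alpha> unfolding a_def Rc_of_real[OF st(1) x] Rc_of_real[OF st(2) x] of_real_diff[symmetric] norm_of_real .
  moreover have "2 * \<beta> * c / (1 - c) = \<beta> / (1 - c) * c + \<beta> / (1 - c) * c"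
    by simp
  ultimately show ?thesis
    using tail[of s] tail[of t] tri[of a u v] unfolding eq u_def[symmetric] v_def[symmetric] by linarith
qed

text \<open>Induction on the length n of the common prefix. Removing a common first letter i turns
  the difference into \<open>g \<circ> fc i\<close> times a derivative that never vanishes, where g
  is the difference for the shifted sequences. As the image of [0,1] contains a nondegenerate
  interval, g cannot vanish on all of it.\<close>

lemma Hsum_distinct:
  assumes gap: "\<And>s t. s 0 \<in> {1..N} \<Longrightarrow> t 0 \<in> {1..N} \<Longrightarrow> s 0 \<noteq> t 0 \<Longrightarrow>
      \<exists>x\<in>{0..1}. Hsum s (complex_of_real x) \<noteq> Hsum t (complex_of_real x)"
    and "\<And>k. k \<le> n \<Longrightarrow> s k \<in> {1..N} \<and> t k \<in> {1..N}" "\<And>k. k < n \<Longrightarrow> s k = t k" "s n \<noteq> t n"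
  shows "\<exists>x\<in>{0..1}. Hsum s (complex_of_real x) \<noteq> Hsum t (complex_of_real x)"
  using assms(2-4)
proof (induction n arbitrary: s t)
  case 0
  then show ?case by (intro gap) auto
next
  case (Suc n)
  have s0: "s 0 \<in> {1..N}" "t 0 = s 0" using Suc.prems by auto
  define g where "g z = Hsum (s \<circ> Suc) z - Hsum (t \<circ> Suc) z" for z
  have g_holo: "g holomorphic_on nbhd \<epsilon>"
    unfolding g_def by (intro holomorphic_on_diff Hsum_holo)
  have "\<exists>x\<in>{0..1}. Hsum (s \<circ> Suc) (complex_of_real x) \<noteq> Hsum (t \<circ> Suc) (complex_of_real x)"
    by (rule Suc.IH) (use Suc.prems in auto)
  then obtain x where x: "x \<in> {0..1}" "g (of_real x) \<noteq> 0"
    unfolding g_def by (metis right_minus_eq)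
  obtain m where m: "m > 0" "\<forall>i\<in>{1..N}. \<forall>z\<in>closure (nbhd \<epsilon>). m \<le> cmod (deriv (fc i) z)"
    using deriv_fc_ge by blast
  have "set [s 0] \<subseteq> {1..N}" using s0 by simp
  then obtain a b where ab: "0 \<le> a" "b \<le> 1" "m ^ length [s 0] \<le> b - a"
      "{a..b} \<subseteq> comp_word \<Phi> [s 0] ` {0..1}"
    using comp_word_image_interval[OF m(2) less_imp_le[OF m(1)]] by blast
  have "a < b" using ab(3) m(1) by simp
  have "complex_of_real x \<in> nbhd \<epsilon>" using x of_real_in_nbhd[OF eps_pos] by blast
  then have "\<exists>y\<in>{a..b}. g (of_real y) \<noteq> 0"
    using holomorphic_zero_on_interval_imp_zero[OF eps_pos g_holo ab(1) \<open>a < b\<close> ab(2)] x(2) by blast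
  then obtain y where y: "y \<in> {0..1}" "g (of_real (\<Phi> (s 0) y)) \<noteq> 0"
    using ab(4) by auto
  have yz: "complex_of_real y \<in> nbhd \<epsilon>" using y of_real_in_nbhd[OF eps_pos] by blast
  have "Hsum s (of_real y) - Hsum t (of_real y) = g (of_real (\<Phi> (s 0) y)) * deriv (fc (s 0)) (of_real y)"
    unfolding Hsum_rec[OF yz, of s] Hsum_rec[OF yz, of t] s0(2) fc_of_real[OF s0(1) y(1)] g_def
    by (simp add: algebra_simps)
  moreover have "deriv (fc (s 0)) (of_real y) \<noteq> 0"
    using fc_closure(2)[OF s0(1)] yz closure_subset by blast
  ultimately show ?case using y by (intro bexI[of _ y]) auto
qed

section \<open>From a uniform gap to exponential separation\<close>

lemma comp_list_of_real:
  "set l \<subseteq> {1..N} \<Longrightarrow> x \<in> {0..1} \<Longrightarrow> comp_list l (of_real x) = of_real (comp_word \<Phi> (rev l) x)"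
  by (induction l arbitrary: x) (simp_all add: comp_word_append fc_of_real Phi_unit del: atLeastAtMost_iff)

text \<open>Interpolation is applied twice: to F - G, whose smallness passes to two derivatives and
  hence to E, and then to E, whose smallness passes to p derivatives. All constants are fixed before
  the words, so they do not depend on n.\<close>

lemma uniform_gap_imp_SESC:
  assumes \<delta>: "\<delta> > 0" and gap: "\<And>s t. s 0 \<in> {1..N} \<Longrightarrow> t 0 \<in> {1..N} \<Longrightarrow> s 0 \<noteq> t 0 \<Longrightarrow>
      \<exists>x\<in>{0..1}. \<delta> \<le> cmod (Hsum s (of_real x) - Hsum t (of_real x))"
  shows "SESC N \<Phi>"
proof -
  obtain m where m: "m > 0" "\<forall>i\<in>{1..N}. \<forall>z\<in>closure (nbhd \<epsilon>). m \<le> cmod (deriv (fc i) z)"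
    using deriv_fc_ge by blast
  have m_nbhd: "m \<le> cmod (deriv (fc i) z)" if "i \<in> {1..N}" "z \<in> nbhd \<epsilon>" for i z
    using m(2) that closure_subset by blast
  have "m < 1" using m(2) nonempty fc_closure(3) by (meson ex_in_conv le_less_trans)
  obtain M where M: "M \<ge> 0" "\<And>s z. z \<in> nbhd \<epsilon> \<Longrightarrow> cmod (Hsum s z) \<le> M"
    using Hsum_bounded by blast
  obtain p d where d: "d > 0" and nondeg: "\<And>g x y. \<lbrakk>x \<in> {0..1::real}; y \<in> {0..1::real};
      g holomorphic_on nbhd \<epsilon>; \<forall>z\<in>nbhd \<epsilon>. cmod (g z) \<le> 2 * M; \<delta> \<le> cmod (g (of_real x))\<rbrakk>
      \<Longrightarrow> \<exists>q\<le>p. cmod ((deriv ^^ q) g (of_real y)) \<ge> d"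
    using uniformly_nondegenerate_derivs[OF eps_pos \<delta>, of "2 * M"] by blast
  \<comment> \<open>For F - G: both values lie in \<open>nbhd \<epsilon>\<close>, hence the bound 2
    (1 + \<epsilon>). Order 2 costs the exponent 4 seen in the separation constant
    \<open>\<theta> ^ 4\<close>.\<close>
  obtain A where A: "A \<ge> 1" and smallA: "\<And>g a b t j x. \<lbrakk>g holomorphic_on nbhd \<epsilon>;
     \<forall>z\<in>nbhd \<epsilon>. cmod (g z) \<le> 2 * (1 + \<epsilon>); 0 \<le> a; b \<le> 1; 0 < t; 2 * t \<le> b - a;
     \<forall>x\<in>{a..b}. cmod (g (of_real x)) \<le> t ^ (2 ^ 2); j \<le> 2; x \<in> {a..b}\<rbrakk>
       \<Longrightarrow> cmod ((deriv ^^ j) g (of_real x)) \<le> A * t"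
    using small_higher_derivs[OF eps_pos, of "2 * (1 + \<epsilon>)" 2] eps_pos by (auto simp del: atLeastAtMost_iff)
  obtain A' where A': "A' \<ge> 1" and smallA': "\<And>g a b t j x. \<lbrakk>g holomorphic_on nbhd \<epsilon>;
     \<forall>z\<in>nbhd \<epsilon>. cmod (g z) \<le> 2 * M; 0 \<le> a; b \<le> 1; 0 < t; 2 * t \<le> b - a;
     \<forall>x\<in>{a..b}. cmod (g (of_real x)) \<le> t ^ (2 ^ p); j \<le> p; x \<in> {a..b}\<rbrakk>
       \<Longrightarrow> cmod ((deriv ^^ j) g (of_real x)) \<le> A' * t"
    using small_higher_derivs[OF eps_pos, of "2 * M" p] M by (auto simp del: atLeastAtMost_iff)
  \<comment> \<open>K collects the constants in the bound for the product of E, F' and G'.\<close>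
  define K where "K = A * (1 + M)"
  have K: "K \<ge> 1" unfolding K_def using A M mult_mono[of 1 A 1 "1 + M"] by simp
  \<comment> \<open>The first entry makes 2 \<kappa> ^ n at most the length of the interval below,
    the second makes A' \<kappa> at most d / 2.\<close>
  define \<kappa> where "\<kappa> = min (m / 2) (d / (2 * A'))"
  have \<kappa>: "\<kappa> > 0" "\<kappa> \<le> m / 2" "\<kappa> \<le> d / (2 * A')" using m d A' by (auto simp: \<kappa>_def)
  \<comment> \<open>The first entry plays the same role as for \<kappa>. The second leaves room for
    K and for division by F' G', which is at least m ^ (2 n) in modulus.\<close>
  define \<theta> where "\<theta> = min (m / 2) (\<kappa> ^ 2 ^ p * m\<^sup>2 / K)"
  have \<theta>: "\<theta> \<le> m / 2" "\<theta> \<le> \<kappa> ^ 2 ^ p * m\<^sup>2 / K"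
    unfolding \<theta>_def by (rule min.cobounded1, rule min.cobounded2)
  have \<theta>_pos: "\<theta> > 0" using m(1) \<kappa>(1) K unfolding \<theta>_def by simp
  have half: "2 * r ^ n \<le> m ^ n" if "0 < r" "r \<le> m / 2" "n \<ge> 1" for r n
  proof -
    have "2 * r ^ n \<le> 2 ^ n * r ^ n"
      using that power_increasing[of 1 n "2::real"] by (intro mult_right_mono) auto
    also have "\<dots> = (2 * r) ^ n" by (simp add: power_mult_distrib)
    also have "\<dots> \<le> m ^ n" using that by (intro power_mono) auto
    finally show ?thesis .
  qed
  show ?thesis unfolding SESC_def
  proof (intro exI[of _ "\<theta> ^ 4"] conjI allI impI; (elim conjE)?)
    show "\<theta> ^ 4 > 0" using \<theta>_pos by simp
  next
    fix n u v
    assume u: "length u = n" "set u \<subseteq> {1..N}" and v: "length v = n" "set v \<subseteq> {1..N}" and "u \<noteq> v"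
    \<comment> \<open>The longest common prefix w of the reversed words is the common innermost
      part. What remains starts with different letters, so the gap hypothesis applies to it.\<close>
    then obtain w a l b l' where ab: "a \<noteq> b" and eq: "rev u = w @ [a] @ l" "rev v = w @ [b] @ l'"
      using same_length_different[of "rev u" "rev v"] by auto
    define lu where "lu = a # l"
    define lv where "lv = b # l'"
    have uv: "u = rev lu @ rev w" "v = rev lv @ rev w"
      using arg_cong[OF eq(1), of rev] arg_cong[OF eq(2), of rev] by (simp_all add: lu_def lv_def)
    have sets: "set lu \<subseteq> {1..N}" "set lv \<subseteq> {1..N}" "set (rev w) \<subseteq> {1..N}"
      using u v uv by auto
    have len: "length lu \<le> n" "length lv \<le> n" "length (rev w) \<le> n" "n \<ge> 1"
      using u(1) v(1) uv by (auto simp: lu_def)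
    show "(\<theta> ^ 4) ^ n \<le> (SUP x\<in>{0..1}. \<bar>comp_word \<Phi> u x - comp_word \<Phi> v x\<bar>)"
    proof (rule ccontr)
      assume contra: "\<not> ?thesis"
      have "\<bar>comp_word \<Phi> u x - comp_word \<Phi> v x\<bar> \<le> 1" if "x \<in> {0..1}" for x
        using comp_word_unit[OF u(2) that] comp_word_unit[OF v(2) that] by auto
      then have "bdd_above ((\<lambda>x. \<bar>comp_word \<Phi> u x - comp_word \<Phi> v x\<bar>) ` {0..1})"
        by (rule bdd_aboveI2)
      then have "\<bar>comp_word \<Phi> u x - comp_word \<Phi> v x\<bar> \<le> (SUP x\<in>{0..1}. \<bar>comp_word \<Phi> u x - comp_word \<Phi> v x\<bar>)"
        if "x \<in> {0..1}" for x
        using that by (rule cSUP_upper[rotated])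
      moreover have "(\<theta> ^ 4) ^ n = (\<theta> ^ n) ^ (2 ^ 2)"
        by (simp add: mult.commute flip: power_mult)
      ultimately have close: "\<bar>comp_word \<Phi> u x - comp_word \<Phi> v x\<bar> \<le> (\<theta> ^ n) ^ (2 ^ 2)" if "x \<in> {0..1}" for x
        using that contra by (smt (verit))
      \<comment> \<open>On [a0,b0], inside the image of the common part h, the difference F - G
        takes only values of the difference of the two full compositions.\<close>
      obtain a0 b0 where J: "0 \<le> a0" "b0 \<le> 1" "m ^ length (rev w) \<le> b0 - a0"
          "{a0..b0} \<subseteq> comp_word \<Phi> (rev w) ` {0..1}"
        using comp_word_image_interval[OF m(2) _ sets(3)] m(1) by auto
      have "m ^ n \<le> m ^ length (rev w)"
        using m(1) \<open>m < 1\<close> len by (intro power_decreasing) auto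
      with J have J_len: "m ^ n \<le> b0 - a0" by linarith
      have J_unit: "{a0..b0} \<subseteq> {0..1}" using J by auto
      then have J_nbhd: "complex_of_real x \<in> nbhd \<epsilon>" if "x \<in> {a0..b0}" for x
        using that of_real_in_nbhd[OF eps_pos] by blast
      define F where "F = comp_list lu"
      define G where "G = comp_list lv"
      have FG_holo: "F holomorphic_on nbhd \<epsilon>" "G holomorphic_on nbhd \<epsilon>"
        by (simp_all add: F_def G_def comp_list_holo)
      define E where "E z = Hsum (pad lu) z - Hsum (pad lv) z" for z
      have D: "cmod ((deriv ^^ j) F (of_real x) - (deriv ^^ j) G (of_real x)) \<le> A * \<theta> ^ n"
        if "j \<le> 2" "x \<in> {a0..b0}" for j x
      proof -
        have "cmod ((deriv ^^ j) (\<lambda>z. F z - G z) (of_real x)) \<le> A * \<theta> ^ n"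
        proof (rule smallA[OF _ _ J(1,2) _ _ _ that])
          show "(\<lambda>z. F z - G z) holomorphic_on nbhd \<epsilon>"
            using FG_holo by (intro holomorphic_on_diff)
          show "\<forall>z\<in>nbhd \<epsilon>. cmod (F z - G z) \<le> 2 * (1 + \<epsilon>)"
          proof
            fix z assume "z \<in> nbhd \<epsilon>"
            then have "F z \<in> nbhd \<epsilon>" "G z \<in> nbhd \<epsilon>" by (simp_all add: F_def G_def comp_list_nbhd)
            then show "cmod (F z - G z) \<le> 2 * (1 + \<epsilon>)"
              using norm_nbhd_less[of "F z"] norm_nbhd_less[of "G z"] norm_triangle_ineq4[of "F z" "G z"]
              by force
          qed
          show "2 * \<theta> ^ n \<le> b0 - a0" using half[OF \<theta>_pos \<theta>(1) len(4)] J_len by linarith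
          show "\<forall>x\<in>{a0..b0}. cmod (F (of_real x) - G (of_real x)) \<le> (\<theta> ^ n) ^ 2\<^sup>2"
          proof
            fix x assume x: "x \<in> {a0..b0}"
            then obtain y where y: "y \<in> {0..1}" "x = comp_word \<Phi> (rev w) y" using J(4) by blast
            have "F (of_real x) - G (of_real x) = of_real (comp_word \<Phi> u y - comp_word \<Phi> v y)"
              unfolding F_def G_def uv comp_word_append using x J_unit sets y
              by (subst (1 2) comp_list_of_real) auto
            then show "cmod (F (of_real x) - G (of_real x)) \<le> (\<theta> ^ n) ^ 2\<^sup>2"
              using close[OF y(1)] by (simp add: norm_of_real del: of_real_diff)
          qed
        qed (use \<theta>_pos in auto)
        then show ?thesis
          using higher_deriv_diff[OF FG_holo open_nbhd J_nbhd[OF that(2)]] by simp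
      qed
      have R: "deriv (deriv (fc i)) z = Rc i z * deriv (fc i) z" if "i \<in> {1..N}" "z \<in> nbhd \<epsilon>" for i z
        using fc_closure(2)[OF that(1)] that(2) closure_subset by (auto simp: Rc_def)
      have R0: "Rc 0 z = 0" for z by (rule fc_pad) auto
      have E_small: "cmod (E (of_real x)) \<le> (\<kappa> ^ n) ^ 2 ^ p" if x: "x \<in> {a0..b0}" for x
      proof -
        let ?z = "complex_of_real x"
        note z = J_nbhd[OF x]
        have F2: "deriv (deriv F) ?z = Hsum (pad lu) ?z * deriv F ?z"
          unfolding F_def using sets(1) by (intro deriv2_comp_list[OF R0 R z]) auto
        have G2: "deriv (deriv G) ?z = Hsum (pad lv) ?z * deriv G ?z"
          unfolding G_def using sets(2) by (intro deriv2_comp_list[OF R0 R z]) auto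
        have "m ^ length lu \<le> cmod (deriv F ?z)" "m ^ length lv \<le> cmod (deriv G ?z)"
          unfolding F_def G_def using m_nbhd m(1) sets(1,2)
          by (auto intro!: deriv_comp_list_ge[of "{1..N}", OF _ _ _ z] simp del: atLeastAtMost_iff)
        moreover have "m ^ n \<le> m ^ length lu" "m ^ n \<le> m ^ length lv"
          using m(1) \<open>m < 1\<close> len by (auto intro!: power_decreasing)
        ultimately have FG_ge: "m ^ n \<le> cmod (deriv F ?z)" "m ^ n \<le> cmod (deriv G ?z)" by linarith+
        have FG_le: "cmod (deriv G ?z) \<le> 1"
          unfolding F_def G_def using z by (auto intro: deriv_comp_list_le_1)
        have G2_le: "cmod (deriv (deriv G) ?z) \<le> M"
          unfolding G2 norm_mult using mult_mono[OF M(2)[OF z] FG_le] M(1) by simp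
        \<comment> \<open>Clearing denominators turns E into F'' G' - G'' F', which is rewritten so
          that each summand contains a derivative of F - G.\<close>
        have "cmod (E ?z) * (m ^ n * m ^ n) \<le> cmod (E ?z) * (cmod (deriv F ?z) * cmod (deriv G ?z))"
          using FG_ge m(1) by (intro mult_left_mono mult_mono) auto
        also have "\<dots> = cmod (E ?z * deriv F ?z * deriv G ?z)" by (simp add: norm_mult)
        also have "E ?z * deriv F ?z * deriv G ?z =
            (deriv (deriv F) ?z - deriv (deriv G) ?z) * deriv G ?z - deriv (deriv G) ?z * (deriv F ?z - deriv G ?z)"
          unfolding F2 G2 E_def by (simp add: algebra_simps)
        also have "cmod \<dots> \<le> cmod (deriv (deriv F) ?z - deriv (deriv G) ?z) * cmod (deriv G ?z)
            + cmod (deriv (deriv G) ?z) * cmod (deriv F ?z - deriv G ?z)"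
          by (metis norm_mult norm_triangle_ineq4)
        also have "\<dots> \<le> (A * \<theta> ^ n) * 1 + M * (A * \<theta> ^ n)"
          using D[of 2 x] D[of 1 x] x FG_le G2_le M(1) A \<theta>_pos
          by (intro add_mono mult_mono) (auto simp: numeral_2_eq_2)
        also have "\<dots> = K * \<theta> ^ n" by (simp add: K_def algebra_simps)
        \<comment> \<open>Since K \<ge> 1 and n \<ge> 1, the constant is absorbed into the n-th
          power.\<close>
        also have "\<dots> \<le> K ^ n * \<theta> ^ n"
          using K \<theta>_pos len(4) by (intro mult_right_mono self_le_power) auto
        also have "\<dots> = (K * \<theta>) ^ n" by (simp add: power_mult_distrib)
        also have "\<dots> \<le> (\<kappa> ^ 2 ^ p * m\<^sup>2) ^ n"
          using \<theta>(2) \<theta>_pos K by (intro power_mono) (auto simp: field_simps)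
        also have "\<dots> = (\<kappa> ^ n) ^ 2 ^ p * (m ^ n * m ^ n)"
          by (simp add: power_mult_distrib power2_eq_square mult_ac flip: power_mult)
        finally show ?thesis using m(1) by simp
      qed
      have E_holo: "E holomorphic_on nbhd \<epsilon>" unfolding E_def by (intro holomorphic_on_diff Hsum_holo)
      have E_le: "\<forall>z\<in>nbhd \<epsilon>. cmod (E z) \<le> 2 * M"
      proof
        fix z assume "z \<in> nbhd \<epsilon>"
        from M(2)[OF this, of "pad lu"] M(2)[OF this, of "pad lv"] show "cmod (E z) \<le> 2 * M"
          unfolding E_def using norm_triangle_ineq4[of "Hsum (pad lu) z" "Hsum (pad lv) z"] by linarith
      qed
      obtain x where x: "x \<in> {0..1}" "\<delta> \<le> cmod (E (of_real x))"
        using gap[of "pad lu" "pad lv"] ab sets by (auto simp: E_def lu_def lv_def pad_Cons)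
      have a0: "a0 \<in> {a0..b0}" using J_len zero_less_power[OF m(1), of n] by auto
      \<comment> \<open>The point x may lie outside [a0,b0]. Nondegeneracy carries the lower bound
        over to a0, where E is known to be small.\<close>
      obtain q where q: "q \<le> p" "d \<le> cmod ((deriv ^^ q) E (of_real a0))"
        using nondeg[OF x(1) _ E_holo E_le x(2), of a0] J_unit a0 by blast
      have "2 * \<kappa> ^ n \<le> b0 - a0" using half[OF \<kappa>(1,2) len(4)] J_len by linarith
      then have "cmod ((deriv ^^ q) E (of_real a0)) \<le> A' * \<kappa> ^ n"
        using \<kappa>(1) E_small by (intro smallA'[OF E_holo E_le J(1,2) _ _ _ q(1) a0]) auto
      also have "\<dots> \<le> A' * \<kappa>"
        using \<kappa> A' \<open>m < 1\<close> len(4) power_decreasing[of 1 n \<kappa>] by (intro mult_left_mono) auto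
      also have "\<dots> \<le> d / 2" using \<kappa>(3) A' by (simp add: field_simps)
      finally show False using q(2) d by linarith
    qed
  qed
qed

section \<open>The first difference of two words and the conclusion\<close>

lemma padded_first_difference:
  assumes vw: "v \<in> words N" "w \<in> words N" "v \<noteq> w" "word_length v = word_length w"
  obtains n where "padded v n \<noteq> padded w n" "\<And>k. k < n \<Longrightarrow> padded v k = padded w k"
    "\<And>k. k \<le> n \<Longrightarrow> padded v k \<in> {1..N} \<and> padded w k \<in> {1..N}"
proof -
  have ex: "\<exists>n. padded v n \<noteq> padded w n"
  proof (cases v)
    case (Fin_word u)
    then obtain u' where u': "w = Fin_word u'" "length u' = length u"
      using vw(4) by (cases w) auto
    then obtain k where "k < length u" "u ! k \<noteq> u' ! k"
      using vw(3) Fin_word by (auto simp: list_eq_iff_nth_eq)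
    then show ?thesis using Fin_word u' by (auto simp: padded_def intro!: exI[of _ k])
  next
    case (Inf_word s)
    then obtain s' where "w = Inf_word s'" using vw(4) by (cases w) auto
    then show ?thesis using vw(3) Inf_word by (auto simp: padded_def fun_eq_iff)
  qed
  define n where "n = (LEAST n. padded v n \<noteq> padded w n)"
  have n: "padded v n \<noteq> padded w n" unfolding n_def using ex by (rule LeastI_ex)
  \<comment> \<open>Beyond the common length both sequences are 0, so a difference can only occur at
    a genuine letter.\<close>
  then have "enat (Suc n) \<le> word_length v" using vw(4) by (auto simp: padded_def split: if_splits)
  then have "enat (Suc k) \<le> word_length v" if "k \<le> n" for k
    using that by (meson Suc_le_mono enat_ord_simps(1) order_trans)
  then have "padded v k \<in> {1..N} \<and> padded w k \<in> {1..N}" if "k \<le> n" for k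
    using that vw unfolding words_def padded_def by auto
  then show ?thesis using that n not_less_Least unfolding n_def by blast
qed

end

theorem proposition1p8:
  fixes \<epsilon> \<alpha> \<beta> :: real and N :: nat and \<Phi> :: "nat \<Rightarrow> real \<Rightarrow> real"
  assumes "\<epsilon> > 0" and "N \<ge> 2" and "\<Phi> \<in> IFS \<epsilon> N" and "\<alpha> > 0"
    and "\<And>i j. i \<in> {1..N} \<Longrightarrow> j \<in> {1..N} \<Longrightarrow> i \<noteq> j \<Longrightarrow>
      \<exists>x\<in>{0..1}. \<bar>deriv (deriv (\<Phi> i)) x / deriv (\<Phi> i) x
                   - deriv (deriv (\<Phi> j)) x / deriv (\<Phi> j) x\<bar> \<ge> \<alpha>"
    and "\<beta> = (SUP (x, i)\<in>{0..1} \<times> {1..N}. \<bar>deriv (deriv (\<Phi> i)) x / deriv (\<Phi> i) x\<bar>)"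
  shows "\<beta> > 0 \<and>
    (\<alpha> > 2 * \<beta> * c_max \<epsilon> N \<Phi> / (1 - c_max \<epsilon> N \<Phi>) \<longrightarrow>
      (\<forall>v\<in>words N. \<forall>w\<in>words N. v \<noteq> w \<and> word_length v = word_length w \<longrightarrow>
         (SUP x\<in>{0..1}. \<bar>H \<Phi> v x - H \<Phi> w x\<bar>) > 0) \<and>
      SESC N \<Phi>)"
proof -
  interpret analytic_ifs \<epsilon> N \<Phi>
    using assms(1-3) by unfold_locales auto
  have in_nbhd: "complex_of_real x \<in> nbhd \<epsilon>" if "x \<in> {0..1}" for x
    using that assms(1) by (rule of_real_in_nbhd[rotated])
  \<comment> \<open>A finite bound is established first, so that the supremum \<beta> really
    dominates every quotient.\<close>
  obtain B where B: "\<And>i z. z \<in> nbhd \<epsilon> \<Longrightarrow> cmod (Rc i z) \<le> B"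
    using R_bounded by blast
  have "\<bar>deriv (deriv (\<Phi> i)) x / deriv (\<Phi> i) x\<bar> \<le> B" if "i \<in> {1..N}" "x \<in> {0..1}" for i x
    using B[OF in_nbhd[OF that(2)], of i] unfolding Rc_of_real[OF that] norm_of_real .
  then have bdd: "bdd_above ((\<lambda>(x, i). \<bar>deriv (deriv (\<Phi> i)) x / deriv (\<Phi> i) x\<bar>) ` ({0..1} \<times> {1..N}))"
    by (intro bdd_aboveI2[where M=B]) (auto simp del: atLeastAtMost_iff abs_divide)
  have \<beta>: "\<bar>deriv (deriv (\<Phi> i)) x / deriv (\<Phi> i) x\<bar> \<le> \<beta>" if "i \<in> {1..N}" "x \<in> {0..1}" for i x
    using cSUP_upper[OF _ bdd, of "(x, i)"] that unfolding assms(6) by simp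
  have "\<beta> > 0"
  proof -
    \<comment> \<open>Two quotients that differ by at least \<alpha> > 0 cannot both be 0, which
      forces \<beta> > 0.\<close>
    have 12: "1 \<in> {1..N}" "2 \<in> {1..N}" using assms(2) by auto
    obtain x where x: "x \<in> {0..1}" "\<alpha> \<le> \<bar>deriv (deriv (\<Phi> 1)) x / deriv (\<Phi> 1) x
                   - deriv (deriv (\<Phi> 2)) x / deriv (\<Phi> 2) x\<bar>"
      using assms(5)[OF 12] by auto
    with \<beta>[OF 12(1) x(1)] \<beta>[OF 12(2) x(1)] assms(4) show ?thesis by linarith
  qed
  moreover have "(\<forall>v\<in>words N. \<forall>w\<in>words N. v \<noteq> w \<and> word_length v = word_length w \<longrightarrow>
         (SUP x\<in>{0..1}. \<bar>H \<Phi> v x - H \<Phi> w x\<bar>) > 0) \<and> SESC N \<Phi>"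
    if \<alpha>: "\<alpha> > 2 * \<beta> * c_max \<epsilon> N \<Phi> / (1 - c_max \<epsilon> N \<Phi>)"
  proof -
    define \<delta> where "\<delta> = \<alpha> - 2 * \<beta> * c / (1 - c)"
    have \<delta>: "\<delta> > 0" using \<alpha> by (simp add: \<delta>_def)
    have gap: "\<exists>x\<in>{0..1}. \<delta> \<le> cmod (Hsum s (of_real x) - Hsum t (of_real x))"
      if st: "s 0 \<in> {1..N}" "t 0 \<in> {1..N}" "s 0 \<noteq> t 0" for s t
    proof -
      obtain x where x: "x \<in> {0..1}" "\<alpha> \<le> \<bar>deriv (deriv (\<Phi> (s 0))) x / deriv (\<Phi> (s 0)) x
          - deriv (deriv (\<Phi> (t 0))) x / deriv (\<Phi> (t 0)) x\<bar>"
        using assms(5)[OF st] by blast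
      show ?thesis unfolding \<delta>_def
        by (rule bexI[OF _ x(1)], rule Hsum_gap[of _ s t, OF _ st(1,2) x], rule \<beta>)
    qed
    have gap0: "\<exists>x\<in>{0..1}. Hsum s (complex_of_real x) \<noteq> Hsum t (complex_of_real x)"
      if st: "s 0 \<in> {1..N}" "t 0 \<in> {1..N}" "s 0 \<noteq> t 0" for s t
    proof -
      obtain x where "x \<in> {0..1}" "\<delta> \<le> cmod (Hsum s (of_real x) - Hsum t (of_real x))"
        using gap[of s t] st by blast
      then show ?thesis using \<delta> by (intro bexI[of _ x]) auto
    qed
    have distinct: "(SUP x\<in>{0..1}. \<bar>H \<Phi> v x - H \<Phi> w x\<bar>) > 0"
      if vw: "v \<in> words N" "w \<in> words N" "v \<noteq> w" "word_length v = word_length w" for v w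
    proof -
      obtain n where n: "padded v n \<noteq> padded w n" "\<And>k. k < n \<Longrightarrow> padded v k = padded w k"
        "\<And>k. k \<le> n \<Longrightarrow> padded v k \<in> {1..N} \<and> padded w k \<in> {1..N}"
        using padded_first_difference[OF vw] by blast
      obtain x where x: "x \<in> {0..1}" "Hsum (padded v) (of_real x) \<noteq> Hsum (padded w) (of_real x)"
        using Hsum_distinct[of n "padded v" "padded w", OF gap0 n(3,2,1)] by blast
      then have ne: "H \<Phi> v x \<noteq> H \<Phi> w x" using vw by (simp add: Hsum_padded)
      obtain M where M: "\<And>s z. z \<in> nbhd \<epsilon> \<Longrightarrow> cmod (Hsum s z) \<le> M"
        using Hsum_bounded by blast
      have H_le: "\<bar>H \<Phi> w x\<bar> \<le> M" if "w \<in> words N" "x \<in> {0..1}" for w x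
        using M[OF in_nbhd[OF that(2)], of "padded w"] unfolding Hsum_padded[OF that] norm_of_real .
      have "\<bar>H \<Phi> v x - H \<Phi> w x\<bar> \<le> 2 * M" if "x \<in> {0..1}" for x
        using H_le[OF vw(1) that] H_le[OF vw(2) that] by linarith
      then have "bdd_above ((\<lambda>x. \<bar>H \<Phi> v x - H \<Phi> w x\<bar>) ` {0..1})" by (rule bdd_aboveI2)
      then have "\<bar>H \<Phi> v x - H \<Phi> w x\<bar> \<le> (SUP x\<in>{0..1}. \<bar>H \<Phi> v x - H \<Phi> w x\<bar>)"
        using x(1) by (rule cSUP_upper[rotated])
      then show ?thesis using ne by linarith
    qed
    have "SESC N \<Phi>" by (rule uniform_gap_imp_SESC[OF \<delta>]) (rule gap)
    then show ?thesis using distinct by blast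
  qed
  ultimately show ?thesis by blast
qed

end
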